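(* Let $m,m',k$ be integers with $0\le m,m'<k$. Then $H_{m'}^k\subset H_m^k$ if and only if $m'-m$ is a non-negative even number. In that case, if $m'\ne m$, the inclusion is strict.
   Context: All functions are real valued on $(-1,1)$. Let $\omega(t)=\sqrt{1-t^2}$. Legendre polynomials: $P_n(t)=\frac{(-1)^n}{2^n n!}\frac{d^n}{dt^n}\big((1-t^2)^n\big)$, $n\ge 0$. For integers $0\le m\le n$, the normalized associated Legendre functions are $Q_n^m:=c_{n,m}\,\omega^m P_n^{(m)}$ with $c_{n,m}=\left(\frac{2n+1}{2}\frac{(n-m)!}{(n+m)!}\right)^{1/2}$; for each fixed $m\ge0$, $\{Q_n^m : n\ge m\}$ is an orthonormal basis of $L^2(-1,1)$. For integer $m\ge 0$ and real $s\ge 0$, $H_m^s$ is the set of $u\in L^2(-1,1)$ with $\|u\|_{m,s}^2:=\sum_{n=m}^\infty (2n+1)^{2s}|(u,Q_n^m)_{L^2(-1,1)}|^2<\infty$. *)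

theory Defs
  imports "HOL-Analysis.Analysis"
begin

definition omega :: "real \<Rightarrow> real" where
  "omega t = sqrt (1 - t\<^sup>2)"

definition legendre :: "nat \<Rightarrow> real \<Rightarrow> real" where
  "legendre n t = (- 1) ^ n / (2 ^ n * fact n) * (deriv ^^ n) (\<lambda>x. (1 - x\<^sup>2) ^ n) t"

(* Only meaningful for m \<le> n: otherwise n - m is truncated. *)
definition assoc_legendre_coeff :: "nat \<Rightarrow> nat \<Rightarrow> real" where
  "assoc_legendre_coeff n m = sqrt ((2 * real n + 1) / 2 * (fact (n - m) / fact (n + m)))"

definition assoc_legendre :: "nat \<Rightarrow> nat \<Rightarrow> real \<Rightarrow> real" where
  "assoc_legendre n m t = assoc_legendre_coeff n m * omega t ^ m * (deriv ^^ m) (legendre n) t"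

(* Elements of L^2(-1,1) are represented by functions on the whole line whose values outside
   (-1,1) are irrelevant, without quotienting by equality almost everywhere on (-1,1). All sets
   below are invariant under that equality, so inclusions between them, strict or not, are the
   inclusions between the corresponding sets of classes. *)
definition L2_interval :: "(real \<Rightarrow> real) set" where
  "L2_interval = {u \<in> borel_measurable (lebesgue_on {-1<..<1}).
     integrable (lebesgue_on {-1<..<1}) (\<lambda>t. (u t)\<^sup>2)}"

definition L2_inner :: "(real \<Rightarrow> real) \<Rightarrow> (real \<Rightarrow> real) \<Rightarrow> real" where
  "L2_inner u v = (LINT t|lebesgue_on {-1<..<1}. u t * v t)"

definition H_space :: "nat \<Rightarrow> real \<Rightarrow> (real \<Rightarrow> real) set" where
  "H_space m s = {u \<in> L2_interval.
     (\<lambda>n. (2 * real n + 1) powr (2 * s) * \<bar>L2_inner u (assoc_legendre n m)\<bar>\<^sup>2) summable_on {m..}}"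

end

theory Submission
  imports Defs "HOL-Computational_Algebra.Polynomial"
begin

text \<open>
  Write \<open>P\<^sub>n\<close> for the Legendre polynomials and \<open>\<omega> = sqrt (1 - t\<^sup>2)\<close>.  The mode
  \<open>m\<close> coefficients of \<open>u\<close> are, up to normalization, the moments
  \<open>A n = (u, \<omega>\<^sup>m P\<^sub>n\<^sup>(\<^sup>m\<^sup>))\<close>, so membership in \<open>H_space m k\<close> is a weighted
  square summability condition on them.  Multiplication by \<open>\<omega>\<^sup>2\<close> links the modes \<open>m\<close> and
  \<open>m + 2\<close>, and both halves of the proof rest on one identity, \<open>omega2_dlegendre_Suc_neighbours\<close>,
  which writes \<open>\<omega>\<^sup>2 P\<^sub>n\<^sub>+\<^sub>1\<^sup>(\<^sup>m\<^sup>+\<^sup>1\<^sup>)\<close> in terms of \<open>P\<^sub>n\<^sup>(\<^sup>m\<^sup>)\<close> and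
  \<open>P\<^sub>n\<^sub>+\<^sub>2\<^sup>(\<^sup>m\<^sup>)\<close>.

  \<^bold>\<open>Inclusion.\<close>  It suffices to pass from \<open>m + 2\<close> to \<open>m\<close>.  If \<open>A'\<close> denotes the moments of
  mode \<open>m + 2\<close>, the identity gives
  \<open>A' (n + 2) - A' n = (n + m + 1) (n + m + 2) A n - (n + 1 - m) (n + 2 - m) A (n + 2)\<close>.  If
  \<open>A n\<close> is divided by \<open>(n + m)! / (n - m)!\<close>, giving \<open>X n\<close>, the right-hand side becomes a multiple
  of \<open>X n - X (n + 2)\<close>, so \<open>X n\<close> is recovered as a tail sum of differences of the \<open>A'\<close>; the
  boundary term at infinity vanishes because the coefficients of an \<open>L\<^sup>2\<close> function are bounded
  (\<open>coefficient_bound\<close>).  A summation by parts and a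
  discrete Hardy inequality (\<open>weighted_hardy\<close>) turn this into the summability required.

  \<^bold>\<open>Non-inclusion.\<close>  The function \<open>\<omega>\<^sup>q\<close> is a multiple of the lowest function of mode
  \<open>q\<close>, hence lies in \<open>H_space q k\<close> for all \<open>k\<close>.  In mode \<open>m\<close> the integrals
  \<open>E n = \<integral> \<omega>\<^sup>m\<^sup>+\<^sup>q P\<^sub>n\<^sup>(\<^sup>m\<^sup>)\<close> satisfy
  \<open>(n + 2 - m) (n + q + 3) E (n + 2) = (n + 1 + m) (n - q) E n\<close>.  Starting from \<open>n = m\<close>, the
  factor \<open>n - q\<close> vanishes at some step exactly when \<open>q - m\<close> is a non-negative even number.
  Otherwise the integrals are quotients of Pochhammer symbols and the limit formula for \<open>1 / \<Gamma>\<close>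
  gives \<open>\<bar>E (m + 2 i)\<bar> \<ge> c i powr (m - q - 2)\<close>.  For \<open>k > q\<close> the terms of the norm are then
  bounded below by a harmonic series (\<open>omega_power_notin_H_space\<close>).
  The same functions show that the inclusions are strict.
\<close>

section \<open>Legendre polynomials and their derivatives\<close>

text \<open>
  The Rodrigues formula with \<open>t\<^sup>2 - 1\<close> in place of \<open>1 - t\<^sup>2\<close>, which absorbs the sign
  \<open>(- 1) ^ n\<close>.
\<close>
definition legendre_poly :: "nat \<Rightarrow> real poly" where
  "legendre_poly n = smult (1 / (2 ^ n * fact n)) ((pderiv ^^ n) ([:-1, 0, 1:] ^ n))"

definition dlegendre :: "nat \<Rightarrow> nat \<Rightarrow> real \<Rightarrow> real" where
  "dlegendre m n t = poly ((pderiv ^^ m) (legendre_poly n)) t"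

lemma deriv_poly_iterate: "(deriv ^^ n) (poly p) = poly ((pderiv ^^ n) p)" for p :: "real poly"
proof (induction n)
  case (Suc n)
  have "deriv (poly q) = poly (pderiv q)" for q :: "real poly"
    by (rule ext) (rule DERIV_imp_deriv, rule poly_DERIV)
  with Suc show ?case by simp
qed simp

lemma legendre_eq_poly: "legendre n = poly (legendre_poly n)"
proof
  fix t :: real
  have "(1 - x\<^sup>2) ^ n = poly ([:1, 0, -1:] ^ n) x" for x :: real
    by (simp add: poly_power power2_eq_square algebra_simps)
  moreover have "[:1, 0, -1:] ^ n = smult ((-1) ^ n) ([:-1, 0, 1:] ^ n :: real poly)"
    by (simp flip: smult_power)
  ultimately have "(\<lambda>x::real. (1 - x\<^sup>2) ^ n) = poly (smult ((-1) ^ n) ([:-1, 0, 1:] ^ n))"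
    by presburger
  then show "legendre n t = poly (legendre_poly n) t"
    by (simp add: legendre_def legendre_poly_def deriv_poly_iterate higher_pderiv_smult
        flip: power_mult_distrib)
qed

lemma assoc_legendre_eq:
  "assoc_legendre n m t = assoc_legendre_coeff n m * (omega t ^ m * dlegendre m n t)"
  by (simp add: assoc_legendre_def legendre_eq_poly deriv_poly_iterate dlegendre_def)

lemma has_real_derivative_dlegendre:
  "(dlegendre m n has_real_derivative dlegendre (Suc m) n t) (at t)"
  unfolding dlegendre_def[abs_def] by (simp add: poly_DERIV)

lemma continuous_on_dlegendre [continuous_intros]: "continuous_on S (dlegendre m n)"
  unfolding dlegendre_def[abs_def] by (intro continuous_intros)

text \<open>
  The Leibniz rule with the factor \<open>t\<close>, whose second derivative vanishes.
\<close>
lemma higher_pderiv_mult_X: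
  "(pderiv ^^ Suc n) ([:0, 1:] * p) = [:0, 1:] * (pderiv ^^ Suc n) p + smult (of_nat (Suc n)) ((pderiv ^^ n) p)"
  for p :: "'a :: {comm_semiring_1, semiring_no_zero_divisors, semiring_char_0} poly"
proof (induction n)
  case 0
  show ?case by (simp add: pderiv_mult pderiv_pCons add.commute)
next
  case (Suc n)
  have "(pderiv ^^ Suc (Suc n)) ([:0, 1:] * p) = pderiv ((pderiv ^^ Suc n) ([:0, 1:] * p))"
    by simp
  also have "\<dots> = pderiv ([:0, 1:] * (pderiv ^^ Suc n) p + smult (of_nat (Suc n)) ((pderiv ^^ n) p))"
    by (simp only: Suc)
  also have "\<dots> = [:0, 1:] * (pderiv ^^ Suc (Suc n)) p + smult (of_nat (Suc (Suc n))) ((pderiv ^^ Suc n) p)"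
    unfolding pderiv_add pderiv_mult pderiv_smult
    by (simp add: pderiv_pCons algebra_simps smult_add_left)
  finally show ?case .
qed

lemma pderiv_rodrigues:
  "pderiv ([:-1, 0, 1:] ^ Suc n) = smult (2 * real (Suc n)) ([:0, 1:] * [:-1, 0, 1:] ^ n)"
proof -
  have "pderiv [:-1, 0, 1:] = smult 2 [:0, 1:: real:]"
    by (simp add: pderiv_pCons)
  then show ?thesis
    unfolding pderiv_power_Suc by (simp add: algebra_simps)
qed

text \<open>
  Both terms come from \<open>t\<^sup>2 = (t\<^sup>2 - 1) + 1\<close>.  All recurrences
  between derivatives of Legendre polynomials follow from this formula and \<open>pderiv_rodrigues\<close>.
\<close>
lemma pderiv2_rodrigues:
  "pderiv (pderiv ([:-1, 0, 1:] ^ Suc (Suc n))) =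
    smult (2 * real (Suc (Suc n))) (smult (2 * real n + 3) ([:-1, 0, 1:] ^ Suc n)
      + smult (2 * real (Suc n)) ([:-1, 0, 1:] ^ n))"
  (is "?L = ?R")
proof -
  have "pderiv ([:0, 1:] * [:-1, 0, 1:] ^ Suc n :: real poly) =
      [:-1, 0, 1:] ^ Suc n + smult (2 * real (Suc n)) ([:0, 1:] * ([:0, 1:] * [:-1, 0, 1:] ^ n))"
    unfolding pderiv_mult pderiv_rodrigues by (simp add: pderiv_pCons algebra_simps)
  also have "[:0, 1:] * ([:0, 1:] * [:-1, 0, 1:] ^ n) = [:-1, 0, 1:] ^ Suc n + ([:-1, 0, 1:] ^ n :: real poly)"
    by (simp add: algebra_simps)
  finally have "pderiv ([:0, 1:] * [:-1, 0, 1:] ^ Suc n :: real poly) =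
      smult (2 * real n + 3) ([:-1, 0, 1:] ^ Suc n) + smult (2 * real (Suc n)) ([:-1, 0, 1:] ^ n)"
    by (simp only:) (rule poly_eqI, simp add: algebra_simps del: power_Suc)
  then show ?thesis
    by (simp only: pderiv_rodrigues pderiv_smult)
qed

lemma dlegendre_rodrigues:
  "dlegendre m n t = poly ((pderiv ^^ (m + n)) ([:-1, 0, 1:] ^ n)) t / (2 ^ n * fact n)"
  by (simp add: dlegendre_def legendre_poly_def higher_pderiv_smult funpow_add)

lemma rodrigues_factor_Suc:
  "2 * real (Suc n) * x / (2 ^ Suc n * fact (Suc n)) = x / (2 ^ n * fact n)"
proof -
  have "2 * real (Suc n) * x / (2 ^ Suc n * fact (Suc n)) =
      (2 * real (Suc n)) * x / ((2 * real (Suc n)) * (2 ^ n * fact n))"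
    by (simp only: power_Suc fact_Suc of_nat_mult of_nat_fact mult_ac)
  also have "\<dots> = x / (2 ^ n * fact n)"
    by (rule mult_divide_mult_cancel_left) simp
  finally show ?thesis .
qed

text \<open>
  One derivative of \<open>(t\<^sup>2 - 1) ^ Suc n\<close> produces \<open>t * (t\<^sup>2 - 1) ^ n\<close>; the Leibniz rule does
  the rest.
\<close>
lemma dlegendre_Suc_Suc:
  "dlegendre (Suc m) (Suc n) t = t * dlegendre (Suc m) n t + (real n + real m + 1) * dlegendre m n t"
proof -
  have "(pderiv ^^ (Suc m + Suc n)) ([:-1, 0, 1:] ^ Suc n :: real poly) =
      (pderiv ^^ Suc (m + n)) (pderiv ([:-1, 0, 1:] ^ Suc n))"
    by (simp only: funpow_Suc_right o_apply add_Suc add_Suc_right)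
  also have "\<dots> = smult (2 * real (Suc n)) ([:0, 1:] * (pderiv ^^ Suc (m + n)) ([:-1, 0, 1:] ^ n)
      + smult (real (Suc (m + n))) ((pderiv ^^ (m + n)) ([:-1, 0, 1:] ^ n)))"
    unfolding pderiv_rodrigues higher_pderiv_smult higher_pderiv_mult_X ..
  finally have eq: "(pderiv ^^ (Suc m + Suc n)) ([:-1, 0, 1:] ^ Suc n :: real poly) = \<dots>" .
  show ?thesis
    unfolding dlegendre_rodrigues eq poly_smult rodrigues_factor_Suc
    by (simp add: add_divide_distrib add_ac del: funpow.simps)
qed

text \<open>
  Apply the remaining derivatives to \<open>pderiv2_rodrigues\<close>.
\<close>
lemma dlegendre_Suc_diff:
  "dlegendre (Suc m) (Suc (Suc n)) t = (2 * real n + 3) * dlegendre m (Suc n) t + dlegendre (Suc m) n t"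
proof -
  have "(pderiv ^^ (Suc m + Suc (Suc n))) ([:-1, 0, 1:] ^ Suc (Suc n) :: real poly) =
      (pderiv ^^ (Suc m + n)) (pderiv (pderiv ([:-1, 0, 1:] ^ Suc (Suc n))))"
    by (simp only: funpow_Suc_right o_apply add_Suc add_Suc_right)
  also have "\<dots> = smult (2 * real (Suc (Suc n)))
     (smult (2 * real n + 3) ((pderiv ^^ (m + Suc n)) ([:-1, 0, 1:] ^ Suc n))
      + smult (2 * real (Suc n)) ((pderiv ^^ (Suc m + n)) ([:-1, 0, 1:] ^ n)))"
    unfolding pderiv2_rodrigues higher_pderiv_smult higher_pderiv_add by simp
  finally have eq: "(pderiv ^^ (Suc m + Suc (Suc n))) ([:-1, 0, 1:] ^ Suc (Suc n) :: real poly) = \<dots>" .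
  show ?thesis
    unfolding dlegendre_rodrigues eq poly_smult rodrigues_factor_Suc poly_add add_divide_distrib
    by simp
qed

text \<open>
  This recurrence and \<open>dlegendre_Suc_Suc\<close> are two linear relations between derivatives of
  \<open>P\<^sub>n\<close> and \<open>P\<^sub>n\<^sub>+\<^sub>1\<close>.  Eliminating from them in different ways gives the two formulas for
  \<open>(1 - t\<^sup>2) P\<^sub>n\<^sup>(\<^sup>m\<^sup>+\<^sup>1\<^sup>)\<close> that follow, and equating these the three-term recurrence.
\<close>
lemma mult_t_dlegendre_Suc:
  "t * dlegendre (Suc m) (Suc n) t = dlegendre (Suc m) n t + (real n + 1 - real m) * dlegendre m (Suc n) t"
  using dlegendre_Suc_Suc[of m "Suc n" t] dlegendre_Suc_diff[of m n t] by (simp add: algebra_simps)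

lemma omega2_dlegendre_Suc_lower:
  "(1 - t\<^sup>2) * dlegendre (Suc m) (Suc n) t =
    (real n + 1 + real m) * dlegendre m n t - (real n + 1 - real m) * (t * dlegendre m (Suc n) t)"
  using dlegendre_Suc_Suc[of m n t] mult_t_dlegendre_Suc[of t m n] by algebra

lemma omega2_dlegendre_Suc_upper:
  "(1 - t\<^sup>2) * dlegendre (Suc m) n t =
    (real n + real m + 1) * (t * dlegendre m n t) - (real n + 1 - real m) * dlegendre m (Suc n) t"
  using dlegendre_Suc_Suc[of m n t] mult_t_dlegendre_Suc[of t m n] by algebra

lemma dlegendre_three_term:
  "(2 * real n + 3) * (t * dlegendre m (Suc n) t) =
    (real n + 2 - real m) * dlegendre m (Suc (Suc n)) t + (real n + 1 + real m) * dlegendre m n t"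
  using omega2_dlegendre_Suc_lower[of t m n] omega2_dlegendre_Suc_upper[of t m "Suc n"] by (simp add: algebra_simps)

text \<open>
  The link between the modes \<open>m\<close> and \<open>m + 2\<close>: by \<open>dlegendre_Suc_diff\<close> the left-hand side equals
  \<open>(1 - t\<^sup>2) (P\<^sub>n\<^sub>+\<^sub>2\<^sup>(\<^sup>m\<^sup>+\<^sup>2\<^sup>) - P\<^sub>n\<^sup>(\<^sup>m\<^sup>+\<^sup>2\<^sup>))\<close>.
\<close>
lemma omega2_dlegendre_Suc_neighbours:
  "(2 * real n + 3) * ((1 - t\<^sup>2) * dlegendre (Suc m) (Suc n) t) =
    (real n + 1 + real m) * (real n + 2 + real m) * dlegendre m n t
    - (real n + 1 - real m) * (real n + 2 - real m) * dlegendre m (Suc (Suc n)) t"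
  using omega2_dlegendre_Suc_lower[of t m n] dlegendre_three_term[of n t m] by algebra

lemma dlegendre_eq_0: "n < m \<Longrightarrow> dlegendre m n t = 0"
proof (induction n arbitrary: m rule: less_induct)
  case (less n)
  then obtain m' where m: "m = Suc m'" by (cases m) auto
  consider "n = 0" | "n = 1" | n' where "n = Suc (Suc n')"
    by (metis One_nat_def not0_implies_Suc)
  then show ?case
  proof cases
    case 1
    then show ?thesis unfolding m dlegendre_def legendre_poly_def
      by (simp add: funpow_Suc_right del: funpow.simps)
  next
    case 2
    with less.prems obtain m'' where "m = Suc (Suc m'')" using m by (cases m') auto
    with 2 show ?thesis unfolding dlegendre_def legendre_poly_def
      by (simp add: funpow_Suc_right pderiv_pCons pderiv_smult del: funpow.simps)
  next
    case 3
    then show ?thesis using less unfolding m by (simp add: dlegendre_Suc_diff)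
  qed
qed

text \<open>
  The Legendre differential equation, differentiated \<open>m\<close> times.
\<close>
lemma dlegendre_ode:
  "(1 - t\<^sup>2) * dlegendre (Suc (Suc m)) n t =
    2 * (real m + 1) * (t * dlegendre (Suc m) n t) - (real n - real m) * (real n + real m + 1) * dlegendre m n t"
proof (cases n)
  case 0
  then show ?thesis by (cases m) (simp_all add: dlegendre_eq_0)
next
  case (Suc n')
  have "dlegendre (Suc m) n' t =
      t * dlegendre (Suc m) (Suc n') t - (real n' + 1 - real m) * dlegendre m (Suc n') t"
    using mult_t_dlegendre_Suc[of t m n'] by simp
  then show ?thesis
    unfolding Suc omega2_dlegendre_Suc_lower[of t "Suc m" n']
    by (simp only: of_nat_Suc) (simp add: algebra_simps)
qed

text \<open>
  The constant is \<open>1 * 3 * \<dots> * (2 n - 1)\<close>.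
\<close>
lemma dlegendre_top_pos: "\<exists>c>0. \<forall>t. dlegendre n n t = c"
proof (induction n)
  case 0
  show ?case by (rule exI[of _ 1]) (simp add: dlegendre_def legendre_poly_def)
next
  case (Suc n)
  then obtain c where c: "c > 0" "\<And>t. dlegendre n n t = c" by blast
  have "dlegendre (Suc n) (Suc n) t = (2 * real n + 1) * c" for t
    by (simp add: dlegendre_Suc_Suc dlegendre_eq_0 c)
  then show ?case using c(1) by (intro exI[of _ "(2 * real n + 1) * c"]) auto
qed

lemma dlegendre_0_0: "dlegendre 0 0 t = 1"
  by (simp add: dlegendre_def legendre_poly_def)

lemma dlegendre_0_1: "dlegendre 0 (Suc 0) t = t"
  by (simp add: dlegendre_def legendre_poly_def pderiv_pCons)

section \<open>Integrals against powers of the weight\<close>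

lemma omega_nonneg: "t \<in> {-1..1} \<Longrightarrow> 0 \<le> omega t"
  by (simp add: omega_def abs_square_le_1 abs_le_iff)

lemma omega_square: "t \<in> {-1..1} \<Longrightarrow> (omega t)\<^sup>2 = 1 - t\<^sup>2"
  by (simp add: omega_def abs_square_le_1 abs_le_iff)

lemma omega_pm1: "omega 1 = 0" "omega (-1) = 0"
  by (simp_all add: omega_def)

lemma continuous_on_omega [continuous_intros]: "continuous_on S omega"
  unfolding omega_def[abs_def] by (intro continuous_intros)

lemma has_real_derivative_omega_power:
  assumes "t \<in> {-1<..<1}"
  shows "((\<lambda>t. omega t ^ (p + 2)) has_real_derivative - (real p + 2) * (t * omega t ^ p)) (at t)"
proof -
  have pos: "1 - t\<^sup>2 > 0"
    using assms by (simp add: abs_square_less_1 abs_less_iff)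
  have "(omega has_real_derivative - t / omega t) (at t)"
    unfolding omega_def[abs_def] using pos
    by (auto intro!: derivative_eq_intros simp: field_simps)
  from DERIV_power[OF this, of "p + 2"] show ?thesis
    using pos by (simp add: omega_def field_simps)
qed

text \<open>
  The boundary terms vanish because \<open>\<omega>\<close> is zero at both endpoints.  Its derivative blows up there,
  so the fundamental theorem of calculus is used in the form that asks for derivatives only in the
  interior.
\<close>
lemma integral_by_parts_omega:
  fixes f f' :: "real \<Rightarrow> real"
  assumes f: "\<And>t. (f has_real_derivative f' t) (at t)" and f': "continuous_on UNIV f'"
  shows "integral {-1..1} (\<lambda>t. omega t ^ (p + 2) * f' t) =
    (real p + 2) * integral {-1..1} (\<lambda>t. omega t ^ p * (t * f t))"
proof -
  have cf: "continuous_on {-1..1} f"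
    by (rule DERIV_continuous_on) (rule has_field_derivative_at_within[OF f])
  have cf': "continuous_on {-1..1} f'"
    using f' by (rule continuous_on_subset) simp
  have "((\<lambda>t. omega t ^ (p + 2) * f' t - (real p + 2) * (omega t ^ p * (t * f t)))
      has_integral (omega 1 ^ (p + 2) * f 1 - omega (-1) ^ (p + 2) * f (-1))) {-1..1}"
  proof (rule fundamental_theorem_of_calculus_interior)
    show "continuous_on {-1..1} (\<lambda>t. omega t ^ (p + 2) * f t)"
      by (intro continuous_intros cf)
    show "((\<lambda>t. omega t ^ (p + 2) * f t) has_vector_derivative
        omega t ^ (p + 2) * f' t - (real p + 2) * (omega t ^ p * (t * f t))) (at t)"
      if "t \<in> {-1<..<1}" for t
      using DERIV_mult[OF has_real_derivative_omega_power[OF that, of p] f[of t]]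
      by (simp add: has_real_derivative_iff_has_vector_derivative algebra_simps)
  qed simp
  then have "integral {-1..1} (\<lambda>t. omega t ^ (p + 2) * f' t - (real p + 2) * (omega t ^ p * (t * f t))) = 0"
    by (simp add: omega_pm1 integral_unique)
  moreover have "integral {-1..1} (\<lambda>t. omega t ^ (p + 2) * f' t - (real p + 2) * (omega t ^ p * (t * f t))) =
      integral {-1..1} (\<lambda>t. omega t ^ (p + 2) * f' t) -
      integral {-1..1} (\<lambda>t. (real p + 2) * (omega t ^ p * (t * f t)))"
    by (intro Henstock_Kurzweil_Integration.integral_diff integrable_continuous_real continuous_intros cf cf')
  ultimately show ?thesis by simp
qed

text \<open>
  Integrating by parts moves one derivative from the second factor to the first; the differential
  equation then replaces the resulting expression by a multiple of \<open>P\<^sub>n\<^sup>(\<^sup>m\<^sup>)\<close>.  For \<open>m = 0\<close> the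
  left-hand side is symmetric in \<open>n\<close> and \<open>j\<close>, which yields orthogonality; for \<open>n = j\<close> it is a
  recursion for the norms.
\<close>
lemma integral_dlegendre_product_Suc:
  "integral {-1..1} (\<lambda>t. omega t ^ (2 * Suc m) * (dlegendre (Suc m) n t * dlegendre (Suc m) j t)) =
    (real n - real m) * (real n + real m + 1) *
    integral {-1..1} (\<lambda>t. omega t ^ (2 * m) * (dlegendre m n t * dlegendre m j t))"
proof -
  let ?I = "\<lambda>f. integral {-1..1} (\<lambda>t. omega t ^ (2 * m) * f t)"
  have int: "(\<lambda>t. omega t ^ (2 * m) * f t) integrable_on {-1..1}" if "continuous_on {-1..1} f" for f
    by (intro integrable_continuous_real continuous_intros that)
  have "integral {-1..1} (\<lambda>t. omega t ^ (2 * m + 2) *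
        (dlegendre (Suc m) n t * dlegendre (Suc m) j t + dlegendre (Suc (Suc m)) n t * dlegendre m j t)) =
      (real (2 * m) + 2) * ?I (\<lambda>t. t * (dlegendre (Suc m) n t * dlegendre m j t))"
    by (rule integral_by_parts_omega)
       (auto intro!: continuous_intros derivative_eq_intros has_real_derivative_dlegendre)
  also have "\<dots> = ?I (\<lambda>t. (real (2 * m) + 2) * (t * (dlegendre (Suc m) n t * dlegendre m j t)))"
    by (simp flip: Henstock_Kurzweil_Integration.integral_mult_right add: mult_ac)
  also have "integral {-1..1} (\<lambda>t. omega t ^ (2 * m + 2) *
        (dlegendre (Suc m) n t * dlegendre (Suc m) j t + dlegendre (Suc (Suc m)) n t * dlegendre m j t)) =
      integral {-1..1} (\<lambda>t. omega t ^ (2 * m + 2) * (dlegendre (Suc m) n t * dlegendre (Suc m) j t)) +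
      integral {-1..1} (\<lambda>t. omega t ^ (2 * m + 2) * (dlegendre (Suc (Suc m)) n t * dlegendre m j t))"
    unfolding distrib_left
    by (intro Henstock_Kurzweil_Integration.integral_add integrable_continuous_real continuous_intros)
  also have "integral {-1..1} (\<lambda>t. omega t ^ (2 * m + 2) * (dlegendre (Suc (Suc m)) n t * dlegendre m j t)) =
      ?I (\<lambda>t. (real (2 * m) + 2) * (t * (dlegendre (Suc m) n t * dlegendre m j t)) -
        (real n - real m) * (real n + real m + 1) * (dlegendre m n t * dlegendre m j t))"
  proof (rule Henstock_Kurzweil_Integration.integral_cong)
    fix t :: real assume t: "t \<in> {-1..1}"
    have "omega t ^ (2 * m + 2) * (dlegendre (Suc (Suc m)) n t * dlegendre m j t) =
        omega t ^ (2 * m) * (((1 - t\<^sup>2) * dlegendre (Suc (Suc m)) n t) * dlegendre m j t)"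
      by (simp only: power_add omega_square[OF t] mult_ac)
    then show "omega t ^ (2 * m + 2) * (dlegendre (Suc (Suc m)) n t * dlegendre m j t) =
       omega t ^ (2 * m) * ((real (2 * m) + 2) * (t * (dlegendre (Suc m) n t * dlegendre m j t)) -
        (real n - real m) * (real n + real m + 1) * (dlegendre m n t * dlegendre m j t))"
      unfolding dlegendre_ode by (simp add: algebra_simps)
  qed
  also have "\<dots> = ?I (\<lambda>t. (real (2 * m) + 2) * (t * (dlegendre (Suc m) n t * dlegendre m j t))) -
      ?I (\<lambda>t. (real n - real m) * (real n + real m + 1) * (dlegendre m n t * dlegendre m j t))"
    unfolding right_diff_distrib[of "omega _ ^ _"]
    by (intro Henstock_Kurzweil_Integration.integral_diff int continuous_intros)
  finally show ?thesis
    by (simp flip: Henstock_Kurzweil_Integration.integral_mult_right add: mult_ac)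
qed

lemma legendre_orthogonal:
  assumes "n \<noteq> j"
  shows "integral {-1..1} (\<lambda>t. dlegendre 0 n t * dlegendre 0 j t) = 0"
proof -
  let ?I = "integral {-1..1} (\<lambda>t. dlegendre 0 n t * dlegendre 0 j t)"
  have "real n * (real n + 1) * ?I = real j * (real j + 1) * ?I"
    using integral_dlegendre_product_Suc[of 0 n j] integral_dlegendre_product_Suc[of 0 j n]
    by (simp add: mult_ac)
  then have "(real n - real j) * (real n + real j + 1) * ?I = 0"
    by (simp add: algebra_simps)
  moreover have "(real n - real j) * (real n + real j + 1) \<noteq> 0"
    using assms by (simp add: add_nonneg_eq_0_iff)
  ultimately show ?thesis by simp
qed

text \<open>
  By orthogonality the three-term recurrence for \<open>t P\<^sub>n\<^sub>+\<^sub>1\<close> evaluates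
  \<open>\<integral> t P\<^sub>n P\<^sub>n\<^sub>+\<^sub>1\<close> as a multiple of \<open>\<integral> P\<^sub>n\<^sup>2\<close>, and the one for \<open>t P\<^sub>n\<close> evaluates it as a
  multiple of \<open>\<integral> P\<^sub>n\<^sub>+\<^sub>1\<^sup>2\<close>.
\<close>
lemma legendre_norm:
  "integral {-1..1} (\<lambda>t. (dlegendre 0 n t)\<^sup>2) = 2 / (2 * real n + 1)"
proof (induction n)
  case 0
  show ?case by (simp add: dlegendre_0_0)
next
  case (Suc n)
  let ?J = "integral {-1..1} (\<lambda>t. t * dlegendre 0 n t * dlegendre 0 (Suc n) t)"
  have int: "(\<lambda>t. dlegendre 0 i t * dlegendre 0 j t) integrable_on {-1..1}" for i j
    by (intro integrable_continuous_real continuous_intros)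
  have intt: "(\<lambda>t. t * dlegendre 0 i t * dlegendre 0 j t) integrable_on {-1..1}" for i j
    by (intro integrable_continuous_real continuous_intros)
  have "(2 * real n + 3) * ?J = integral {-1..1} (\<lambda>t. (2 * real n + 3) * (t * dlegendre 0 (Suc n) t) * dlegendre 0 n t)"
    by (simp flip: Henstock_Kurzweil_Integration.integral_mult_right add: mult_ac)
  also have "\<dots> = integral {-1..1} (\<lambda>t. (real n + 2) * (dlegendre 0 (Suc (Suc n)) t * dlegendre 0 n t)
      + (real n + 1) * (dlegendre 0 n t * dlegendre 0 n t))"
    unfolding dlegendre_three_term by (simp add: algebra_simps)
  also have "\<dots> = (real n + 1) * integral {-1..1} (\<lambda>t. (dlegendre 0 n t)\<^sup>2)"
    by (simp add: Henstock_Kurzweil_Integration.integral_add int legendre_orthogonal power2_eq_square)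
  finally have 1: "(2 * real n + 3) * ?J = (real n + 1) * integral {-1..1} (\<lambda>t. (dlegendre 0 n t)\<^sup>2)" .
  have 2: "(2 * real n + 1) * ?J = (real n + 1) * integral {-1..1} (\<lambda>t. (dlegendre 0 (Suc n) t)\<^sup>2)"
  proof (cases n)
    case 0
    then show ?thesis by (simp add: dlegendre_0_0 dlegendre_0_1 power2_eq_square)
  next
    case n: (Suc n')
    have "(2 * real n + 1) * ?J = integral {-1..1} (\<lambda>t. (2 * real n' + 3) * (t * dlegendre 0 (Suc n') t) * dlegendre 0 (Suc n) t)"
      by (simp flip: Henstock_Kurzweil_Integration.integral_mult_right add: mult_ac n add_ac)
    also have "\<dots> = integral {-1..1} (\<lambda>t. (real n' + 2) * (dlegendre 0 (Suc (Suc n')) t * dlegendre 0 (Suc n) t)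
        + (real n' + 1) * (dlegendre 0 n' t * dlegendre 0 (Suc n) t))"
      unfolding dlegendre_three_term by (simp add: algebra_simps)
    also have "\<dots> = (real n + 1) * integral {-1..1} (\<lambda>t. (dlegendre 0 (Suc n) t)\<^sup>2)"
      by (simp add: Henstock_Kurzweil_Integration.integral_add int legendre_orthogonal power2_eq_square n)
    finally show ?thesis .
  qed
  let ?N = "integral {-1..1} (\<lambda>t. (dlegendre 0 (Suc n) t)\<^sup>2)"
  have "(real n + 1) * ((2 * real n + 3) * ?N) = (2 * real n + 3) * ((2 * real n + 1) * ?J)"
    unfolding 2 by (rule mult.left_commute)
  also have "\<dots> = (2 * real n + 1) * ((2 * real n + 3) * ?J)"
    by (rule mult.left_commute)
  also have "\<dots> = (real n + 1) * ((2 * real n + 1) * (2 / (2 * real n + 1)))"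
    unfolding 1 Suc by (rule mult.left_commute)
  also have "(2 * real n + 1) * (2 / (2 * real n + 1)) = 2"
    by (simp add: divide_eq_eq add_nonneg_eq_0_iff)
  finally have "(2 * real n + 3) * ?N = 2"
    by (metis mult_cancel_left of_nat_Suc of_nat_neq_0 add.commute)
  then show ?case by (simp add: eq_divide_eq mult.commute add.commute)
qed

lemma dlegendre_norm:
  assumes "m \<le> n"
  shows "integral {-1..1} (\<lambda>t. omega t ^ (2 * m) * (dlegendre m n t)\<^sup>2) =
    2 / (2 * real n + 1) * (fact (n + m) / fact (n - m))"
  using assms
proof (induction m)
  case 0
  then show ?case by (simp add: legendre_norm)
next
  case (Suc m)
  then have "n - m = Suc (n - Suc m)" by simp
  then have f1: "fact (n - m) = (real n - real m) * fact (n - Suc m)"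
    using Suc.prems by (simp add: of_nat_diff)
  have f3: "(real n - real m) > 0" using Suc.prems by simp
  have f2: "fact (n + Suc m) = (real n + real m + 1) * fact (n + m)" by simp
  have f4: "d * e * (c * (F / (d * f))) = c * (e * F / f)" if "d > 0" for c d e f F :: real
    using that by simp
  have eq: "(real n - real m) * (real n + real m + 1) *
      (2 / (2 * real n + 1) * (fact (n + m) / fact (n - m))) =
      2 / (2 * real n + 1) * (fact (n + Suc m) / fact (n - Suc m))"
    by (simp only: f1 f2 f4[OF f3])
  show ?case
    using integral_dlegendre_product_Suc[of m n n] Suc eq
    unfolding power2_eq_square by simp
qed

section \<open>A discrete Hardy inequality\<close>

lemma telescoping_bound:
  fixes y h :: "nat \<Rightarrow> real"
  assumes step: "\<And>i. \<bar>y i\<bar> \<le> \<bar>y (i + 2)\<bar> + h i" and h: "\<And>i. 0 \<le> h i"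
  shows "\<bar>y i\<bar> \<le> \<bar>y (i + 2 * n)\<bar> + (\<Sum>j=i..<i + 2 * n. h j)"
proof (induction n)
  case (Suc n)
  have eq: "i + 2 * Suc n = Suc (Suc (i + 2 * n))" by simp
  have "\<bar>y (i + 2 * n)\<bar> \<le> \<bar>y (i + 2 * Suc n)\<bar> + h (i + 2 * n)"
    using step[of "i + 2 * n"] by simp
  moreover have "(\<Sum>j=i..<i + 2 * Suc n. h j) =
      (\<Sum>j=i..<i + 2 * n. h j) + h (i + 2 * n) + h (Suc (i + 2 * n))"
    unfolding eq by simp
  ultimately show ?case using Suc h[of "Suc (i + 2 * n)"] by linarith
qed simp

lemma sum_inverse_consecutive:
  "i \<le> n \<Longrightarrow> (\<Sum>j=i..<n. 1 / ((real j + 1) * (real j + 2))) = 1 / (real i + 1) - 1 / (real n + 1)"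
proof (induction n rule: dec_induct)
  case (step n)
  have "1 / ((real n + 1) * (real n + 2)) = 1 / (real n + 1) - 1 / (real (Suc n) + 1)"
    by (simp add: field_simps)
  with step show ?case by (simp add: add_ac)
qed simp

text \<open>
  Cauchy-Schwarz with weights \<open>1 / ((j + 1) (j + 2))\<close>, whose sum telescopes to at most
  \<open>1 / (i + 1)\<close>.
\<close>
lemma square_sum_tail_le:
  fixes h :: "nat \<Rightarrow> real"
  assumes "i \<le> n"
  shows "(\<Sum>j=i..<n. h j)\<^sup>2 \<le> (\<Sum>j=i..<n. (real j + 1) * (real j + 2) * (h j)\<^sup>2) / (real i + 1)"
proof -
  let ?w = "\<lambda>j. (real j + 1) * (real j + 2)"
  have "(\<Sum>j=i..<n. h j)\<^sup>2 = (\<Sum>j=i..<n. 1 / sqrt (?w j) * (sqrt (?w j) * h j))\<^sup>2"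
    by (intro arg_cong[where f = "\<lambda>x. x\<^sup>2"] sum.cong) auto
  also have "\<dots> \<le> (\<Sum>j=i..<n. (1 / sqrt (?w j))\<^sup>2) * (\<Sum>j=i..<n. (sqrt (?w j) * h j)\<^sup>2)"
    by (rule Cauchy_Schwarz_ineq_sum)
  also have "\<dots> = (\<Sum>j=i..<n. 1 / ?w j) * (\<Sum>j=i..<n. ?w j * (h j)\<^sup>2)"
    by (simp add: power_mult_distrib power_divide)
  also have "\<dots> \<le> 1 / (real i + 1) * (\<Sum>j=i..<n. ?w j * (h j)\<^sup>2)"
    unfolding sum_inverse_consecutive[OF assms] by (intro mult_right_mono sum_nonneg) auto
  finally show ?thesis by simp
qed

text \<open>
  The hypotheses bound \<open>\<bar>y i\<bar>\<close> by the tail sum of \<open>h\<close>, and \<open>square_sum_tail_le\<close> bounds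
  \<open>(i + 1) (y i)\<^sup>2\<close> by the tail \<open>T i\<close> of the series with terms
  \<open>q j = (j + 1) (j + 2) (h j)\<^sup>2\<close>.  Exchanging the order of summation in \<open>\<Sum>i. v i * T i\<close> leaves
  the factor \<open>\<Sum>i\<le>j. v i \<le> (j + 1) v j\<close>, by monotonicity of \<open>v\<close>.
\<close>
lemma weighted_hardy:
  fixes y h v :: "nat \<Rightarrow> real"
  assumes y: "y \<longlonglongrightarrow> 0"
    and step: "\<And>i. \<bar>y i\<bar> \<le> \<bar>y (i + 2)\<bar> + h i" and h: "\<And>i. 0 \<le> h i"
    and v: "mono v" "0 < v 0"
    and sm: "summable (\<lambda>i. (real i + 1) ^ 3 * v i * (h i)\<^sup>2)"
  shows "summable (\<lambda>i. (real i + 1) * v i * (y i)\<^sup>2)"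
proof -
  define q where "q j = (real j + 1) * (real j + 2) * (h j)\<^sup>2" for j
  have vpos: "0 < v i" for i
    using v monoD[OF v(1), of 0 i] by simp
  have q0: "0 \<le> q j" for j by (simp add: q_def)
  have vq: "(real j + 1) * (v j * q j) \<le> 2 * ((real j + 1) ^ 3 * v j * (h j)\<^sup>2)" for j
  proof -
    have "(real j + 1) * (v j * q j) = ((real j + 1)\<^sup>2 * v j * (h j)\<^sup>2) * (real j + 2)"
      by (simp add: q_def power2_eq_square)
    also have "\<dots> \<le> ((real j + 1)\<^sup>2 * v j * (h j)\<^sup>2) * (2 * (real j + 1))"
      using vpos[of j] by (intro mult_left_mono) auto
    also have "\<dots> = 2 * ((real j + 1) ^ 3 * v j * (h j)\<^sup>2)"
      by (simp only: power2_eq_square power3_eq_cube mult_ac)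
    finally show ?thesis .
  qed
  have sm_vq: "summable (\<lambda>j. (real j + 1) * (v j * q j))"
    by (rule summable_comparison_test'[OF summable_mult[OF sm, of 2]])
       (use vq q0 vpos in \<open>auto simp: abs_mult less_imp_le\<close>)
  have sm_q: "summable q"
  proof (rule summable_comparison_test'[OF summable_mult[OF sm_vq, of "1 / v 0"]])
    fix j
    have "v 0 * q j \<le> v j * q j"
      using monoD[OF v(1), of 0 j] q0 by (intro mult_right_mono) auto
    also have "\<dots> \<le> (real j + 1) * (v j * q j)"
      using q0[of j] vpos[of j] by (simp add: distrib_right)
    finally show "norm (q j) \<le> 1 / v 0 * ((real j + 1) * (v j * q j))"
      using q0[of j] v(2) by (simp add: field_simps)
  qed
  define T where "T i = (\<Sum>j. if i \<le> j then q j else 0)" for i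
  have sm_T: "summable (\<lambda>j. if i \<le> j then q j else 0)" for i
    by (rule summable_comparison_test'[OF sm_q]) (use q0 in auto)
  have yT: "(real i + 1) * (y i)\<^sup>2 \<le> T i" for i
  proof -
    have "\<bar>y i\<bar> - \<bar>y (i + 2 * n)\<bar> \<le> sqrt (T i / (real i + 1))" for n
    proof -
      have "(\<Sum>j=i..<i + 2 * n. q j) = (\<Sum>j=i..<i + 2 * n. if i \<le> j then q j else 0)"
        by (intro sum.cong) auto
      also have "\<dots> \<le> T i"
        unfolding T_def by (rule sum_le_suminf[OF sm_T]) (use q0 in auto)
      finally have "(\<Sum>j=i..<i + 2 * n. h j)\<^sup>2 \<le> T i / (real i + 1)"
        using square_sum_tail_le[of i "i + 2 * n" h] unfolding q_def
        by (smt (verit) divide_right_mono le_add1 of_nat_0_le_iff)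
      then have "(\<Sum>j=i..<i + 2 * n. h j) \<le> sqrt (T i / (real i + 1))"
        by (rule real_le_rsqrt)
      then show ?thesis using telescoping_bound[of y h i n, OF step h] by linarith
    qed
    moreover have "(\<lambda>n. \<bar>y i\<bar> - \<bar>y (i + 2 * n)\<bar>) \<longlonglongrightarrow> \<bar>y i\<bar> - \<bar>0\<bar>"
    proof (intro tendsto_intros)
      have "filterlim (\<lambda>n. i + 2 * n) sequentially sequentially"
        by (rule filterlim_subseq) (auto simp: strict_mono_def)
      with y show "(\<lambda>n. y (i + 2 * n)) \<longlonglongrightarrow> 0"
        by (rule filterlim_compose)
    qed
    ultimately have "\<bar>y i\<bar> \<le> sqrt (T i / (real i + 1))"
      by (intro LIMSEQ_le_const2[where X = "\<lambda>n. \<bar>y i\<bar> - \<bar>y (i + 2 * n)\<bar>"]) auto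
    moreover have "0 \<le> T i"
      unfolding T_def by (rule suminf_nonneg[OF sm_T]) (use q0 in auto)
    ultimately have "(y i)\<^sup>2 \<le> T i / (real i + 1)"
      by (metis abs_ge_zero power2_abs power_mono real_sqrt_pow2 divide_nonneg_nonneg
          of_nat_0_le_iff add_nonneg_nonneg zero_le_one)
    then show ?thesis by (simp add: field_simps)
  qed
  have bound: "(\<Sum>i<n. norm ((real i + 1) * v i * (y i)\<^sup>2)) \<le> (\<Sum>j. (real j + 1) * (v j * q j))" for n
  proof -
    have "(\<Sum>i<n. norm ((real i + 1) * v i * (y i)\<^sup>2)) \<le> (\<Sum>i<n. v i * T i)"
    proof (rule sum_mono)
      fix i
      show "norm ((real i + 1) * v i * (y i)\<^sup>2) \<le> v i * T i"
        using mult_left_mono[OF yT[of i], of "v i"] vpos[of i]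
        by (simp add: abs_mult mult_ac less_imp_le)
    qed
    also have "\<dots> = (\<Sum>i<n. \<Sum>j. v i * (if i \<le> j then q j else 0))"
      unfolding T_def by (simp only: suminf_mult[OF sm_T])
    also have "\<dots> = (\<Sum>j. \<Sum>i<n. v i * (if i \<le> j then q j else 0))"
      by (rule suminf_sum[symmetric]) (rule summable_mult[OF sm_T])
    also have "\<dots> \<le> (\<Sum>j. (real j + 1) * (v j * q j))"
    proof (rule suminf_le)
      fix j
      have "(\<Sum>i<n. v i * (if i \<le> j then q j else 0)) = (\<Sum>i\<in>{..<n} \<inter> {..j}. v i * q j)"
        by (simp add: sum.inter_restrict if_distrib cong: if_cong)
      also have "\<dots> \<le> (\<Sum>i\<in>{..j}. v i * q j)"
        using q0 vpos by (intro sum_mono2) (auto simp: less_imp_le)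
      also have "\<dots> \<le> (\<Sum>i\<in>{..j}. v j * q j)"
        using q0 by (intro sum_mono mult_right_mono monoD[OF v(1)]) auto
      finally show "(\<Sum>i<n. v i * (if i \<le> j then q j else 0)) \<le> (real j + 1) * (v j * q j)"
        by (simp add: add.commute)
    qed (intro summable_sum summable_mult sm_T sm_vq)+
    finally show ?thesis .
  qed
  then show ?thesis by (intro summable_norm_cancel[OF summableI_nonneg_bounded[OF _ bound]]) auto
qed

section \<open>Coefficients of square integrable functions\<close>

text \<open>
  The discriminant argument for the quadratic function \<open>s \<mapsto> \<integral> (u - s v)\<^sup>2 \<ge> 0\<close>.
\<close>
lemma cauchy_schwarz_integral:
  fixes u v :: "'a \<Rightarrow> real"
  assumes meas: "u \<in> borel_measurable M" "v \<in> borel_measurable M"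
    and u: "integrable M (\<lambda>x. (u x)\<^sup>2)" and v: "integrable M (\<lambda>x. (v x)\<^sup>2)"
  shows "integrable M (\<lambda>x. u x * v x)"
    and "(LINT x|M. u x * v x)\<^sup>2 \<le> (LINT x|M. (u x)\<^sup>2) * (LINT x|M. (v x)\<^sup>2)"
proof -
  show uv: "integrable M (\<lambda>x. u x * v x)"
  proof (rule Bochner_Integration.integrable_bound[OF Bochner_Integration.integrable_add[OF u v]])
    show "AE x in M. norm (u x * v x) \<le> norm ((u x)\<^sup>2 + (v x)\<^sup>2)"
    proof (rule AE_I2)
      fix x
      have "2 * (\<bar>u x\<bar> * \<bar>v x\<bar>) \<le> \<bar>u x\<bar>\<^sup>2 + \<bar>v x\<bar>\<^sup>2"
        using sum_squares_bound[of "\<bar>u x\<bar>" "\<bar>v x\<bar>"] by (simp only: mult.assoc)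
      moreover have "0 \<le> \<bar>u x\<bar> * \<bar>v x\<bar>" by simp
      ultimately have "\<bar>u x\<bar> * \<bar>v x\<bar> \<le> \<bar>u x\<bar>\<^sup>2 + \<bar>v x\<bar>\<^sup>2" by linarith
      then show "norm (u x * v x) \<le> norm ((u x)\<^sup>2 + (v x)\<^sup>2)"
        by (simp add: abs_mult)
    qed
  qed (use meas in measurable)
  let ?a = "LINT x|M. (v x)\<^sup>2" and ?b = "LINT x|M. u x * v x" and ?c = "LINT x|M. (u x)\<^sup>2"
  have pos: "0 \<le> ?c - 2 * s * ?b + s\<^sup>2 * ?a" for s
  proof -
    have "0 \<le> (LINT x|M. (u x - s * v x)\<^sup>2)" by simp
    also have "\<dots> = (LINT x|M. (u x)\<^sup>2 - 2 * s * (u x * v x) + s\<^sup>2 * (v x)\<^sup>2)"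
      by (simp add: power2_eq_square algebra_simps)
    also have "\<dots> = ?c - 2 * s * ?b + s\<^sup>2 * ?a"
      using u v uv by simp
    finally show ?thesis .
  qed
  have a0: "0 \<le> ?a" by simp
  show "?b\<^sup>2 \<le> ?c * ?a"
  proof (cases "?a = 0")
    case True
    have "?b = 0"
    proof (rule ccontr)
      assume "?b \<noteq> 0"
      \<comment> \<open>A non-constant affine function of \<open>s\<close> is negative somewhere.\<close>
      then show False using pos[of "(?c + 1) / (2 * ?b)"] True by simp
    qed
    then show ?thesis by simp
  next
    case False
    then have "?c - 2 * (?b / ?a) * ?b + (?b / ?a)\<^sup>2 * ?a = (?c * ?a - ?b\<^sup>2) / ?a"
      by (simp add: field_simps power2_eq_square)
    with pos[of "?b / ?a"] have "0 \<le> (?c * ?a - ?b\<^sup>2) / ?a" by simp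
    moreover have "0 < ?a" using a0 False by linarith
    ultimately show ?thesis by (simp add: zero_le_divide_iff)
  qed
qed

lemma continuous_on_interval_integral:
  fixes f :: "real \<Rightarrow> real"
  assumes "continuous_on {-1..1} f"
  shows "integrable (lebesgue_on {-1<..<1}) f"
    and "(LINT t|lebesgue_on {-1<..<1}. f t) = integral {-1..1} f"
proof -
  have "f absolutely_integrable_on {-1<..<1}"
    using absolutely_integrable_continuous_real[OF assms]
    by (rule set_integrable_subset) auto
  then show "integrable (lebesgue_on {-1<..<1}) f"
    by (rule absolutely_integrable_imp_integrable) simp
  then have "(LINT t|lebesgue_on {-1<..<1}. f t) = integral {-1<..<1} f"
    by (rule lebesgue_integral_eq_integral) simp
  then show "(LINT t|lebesgue_on {-1<..<1}. f t) = integral {-1..1} f"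
    by (simp only: integral_open_interval_real)
qed

lemma continuous_on_imp_L2_interval:
  "continuous_on {-1..1} f \<Longrightarrow> f \<in> L2_interval"
  unfolding L2_interval_def
  by (auto intro!: continuous_on_interval_integral continuous_intros
      borel_measurable_integrable[OF continuous_on_interval_integral(1)])

lemma L2_interval_mult_integrable:
  assumes "u \<in> L2_interval" "v \<in> L2_interval"
  shows "integrable (lebesgue_on {-1<..<1}) (\<lambda>t. u t * v t)"
  using assms unfolding L2_interval_def by (intro cauchy_schwarz_integral) auto

lemma L2_inner_square_le:
  assumes "u \<in> L2_interval" "v \<in> L2_interval"
  shows "(L2_inner u v)\<^sup>2 \<le> L2_inner u u * L2_inner v v"
  using assms cauchy_schwarz_integral(2)[of u "lebesgue_on {-1<..<1}" v]
  unfolding L2_interval_def L2_inner_def power2_eq_square by auto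

definition omega_moment :: "(real \<Rightarrow> real) \<Rightarrow> nat \<Rightarrow> nat \<Rightarrow> real" where
  "omega_moment u m n = L2_inner u (\<lambda>t. omega t ^ m * dlegendre m n t)"

lemma L2_inner_assoc_legendre:
  "L2_inner u (assoc_legendre n m) = assoc_legendre_coeff n m * omega_moment u m n"
  unfolding L2_inner_def omega_moment_def assoc_legendre_eq
  by (subst integral_mult_right_zero[symmetric]) (simp add: mult_ac)

lemma assoc_legendre_coeff_square:
  "(assoc_legendre_coeff n m)\<^sup>2 = (2 * real n + 1) / 2 * (fact (n - m) / fact (n + m))"
  by (simp add: assoc_legendre_coeff_def)

lemma continuous_on_assoc_legendre: "continuous_on S (assoc_legendre n m)"
  unfolding assoc_legendre_eq[abs_def] by (intro continuous_intros)

lemma assoc_legendre_normalized: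
  assumes "m \<le> n"
  shows "L2_inner (assoc_legendre n m) (assoc_legendre n m) = 1"
proof -
  have "L2_inner (assoc_legendre n m) (assoc_legendre n m) =
      integral {-1..1} (\<lambda>t. assoc_legendre n m t * assoc_legendre n m t)"
    unfolding L2_inner_def
    by (intro continuous_on_interval_integral continuous_intros continuous_on_assoc_legendre)
  also have "\<dots> = integral {-1..1} (\<lambda>t. (assoc_legendre_coeff n m)\<^sup>2 *
      (omega t ^ (2 * m) * (dlegendre m n t)\<^sup>2))"
    unfolding assoc_legendre_eq power2_eq_square mult_2 power_add by (simp add: mult_ac)
  also have "\<dots> = (assoc_legendre_coeff n m)\<^sup>2 * (2 / (2 * real n + 1) * (fact (n + m) / fact (n - m)))"
    by (simp add: dlegendre_norm[OF assms])
  also have "\<dots> = 1"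
    unfolding assoc_legendre_coeff_square by (simp add: field_simps add_nonneg_eq_0_iff)
  finally show ?thesis .
qed

text \<open>
  By the Cauchy-Schwarz inequality, since the functions are normalized.  The bound makes the
  boundary terms at infinity vanish in the telescoping sums of \<open>H_space_step\<close>.
\<close>
lemma coefficient_bound:
  assumes "u \<in> L2_interval" "m \<le> n"
  shows "(L2_inner u (assoc_legendre n m))\<^sup>2 \<le> L2_inner u u"
  using L2_inner_square_le[OF assms(1) continuous_on_imp_L2_interval[OF continuous_on_assoc_legendre[of _ n m]]]
  by (simp add: assoc_legendre_normalized[OF assms(2)])

lemma H_space_iff_summable:
  "u \<in> H_space m (real k) \<longleftrightarrow> u \<in> L2_interval \<and>
    summable (\<lambda>i. (2 * real (m + i) + 1) ^ (2 * k) * (L2_inner u (assoc_legendre (m + i) m))\<^sup>2)"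
proof -
  let ?f = "\<lambda>n. (2 * real n + 1) powr (2 * real k) * \<bar>L2_inner u (assoc_legendre n m)\<bar>\<^sup>2"
  have f: "?f n = (2 * real n + 1) ^ (2 * k) * (L2_inner u (assoc_legendre n m))\<^sup>2" for n
    using powr_realpow[of "2 * real n + 1" "2 * k"] by simp
  have "?f summable_on {m..} \<longleftrightarrow> (\<lambda>i. ?f (m + i)) summable_on UNIV"
    by (rule summable_on_reindex_bij_witness[of _ "\<lambda>i. m + i" "\<lambda>n. n - m"]) auto
  also have "\<dots> \<longleftrightarrow> summable (\<lambda>i. ?f (m + i))"
    by (rule summable_on_UNIV_nonneg_real_iff) simp
  also have "(\<lambda>i. ?f (m + i)) =
      (\<lambda>i. (2 * real (m + i) + 1) ^ (2 * k) * (L2_inner u (assoc_legendre (m + i) m))\<^sup>2)"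
    by (rule ext) (rule f)
  finally show ?thesis
    unfolding H_space_def mem_Collect_eq by (rule arg_cong)
qed

text \<open>
  The identity \<open>omega2_dlegendre_Suc_neighbours\<close>, integrated against \<open>u \<omega>\<^sup>m\<close>.
\<close>
lemma omega_moment_rec:
  assumes u: "u \<in> L2_interval"
  shows "omega_moment u (m + 2) (n + 2) - omega_moment u (m + 2) n =
    (real n + 1 + real m) * (real n + 2 + real m) * omega_moment u m n
    - (real n + 1 - real m) * (real n + 2 - real m) * omega_moment u m (n + 2)"
proof -
  have int: "integrable (lebesgue_on {-1<..<1}) (\<lambda>t. u t * (omega t ^ p * dlegendre m n t))" for p m n
    by (intro L2_interval_mult_integrable u continuous_on_imp_L2_interval continuous_intros)
  have "omega_moment u (m + 2) (n + 2) - omega_moment u (m + 2) n =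
      (LINT t|lebesgue_on {-1<..<1}. u t * (omega t ^ (m + 2) * dlegendre (m + 2) (n + 2) t)
        - u t * (omega t ^ (m + 2) * dlegendre (m + 2) n t))"
    unfolding omega_moment_def L2_inner_def
    by (rule Bochner_Integration.integral_diff[symmetric]) (rule int)+
  also have "\<dots> = (LINT t|lebesgue_on {-1<..<1}.
      (real n + 1 + real m) * (real n + 2 + real m) * (u t * (omega t ^ m * dlegendre m n t))
      - (real n + 1 - real m) * (real n + 2 - real m) * (u t * (omega t ^ m * dlegendre m (n + 2) t)))"
  proof (rule Bochner_Integration.integral_cong)
    fix t :: real assume "t \<in> space (lebesgue_on {-1<..<1})"
    then have t: "t \<in> {-1..1}" by simp
    have "u t * (omega t ^ (m + 2) * dlegendre (m + 2) (n + 2) t)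
        - u t * (omega t ^ (m + 2) * dlegendre (m + 2) n t) =
        u t * (omega t ^ m * ((omega t)\<^sup>2 * (dlegendre (m + 2) (n + 2) t - dlegendre (m + 2) n t)))"
      by (simp add: power_add power2_eq_square algebra_simps)
    also have "(omega t)\<^sup>2 * (dlegendre (m + 2) (n + 2) t - dlegendre (m + 2) n t) =
        (2 * real n + 3) * ((1 - t\<^sup>2) * dlegendre (Suc m) (Suc n) t)"
      using dlegendre_Suc_diff[of "Suc m" n t] unfolding omega_square[OF t] by simp
    finally show "u t * (omega t ^ (m + 2) * dlegendre (m + 2) (n + 2) t)
        - u t * (omega t ^ (m + 2) * dlegendre (m + 2) n t) =
        (real n + 1 + real m) * (real n + 2 + real m) * (u t * (omega t ^ m * dlegendre m n t))
      - (real n + 1 - real m) * (real n + 2 - real m) * (u t * (omega t ^ m * dlegendre m (n + 2) t))"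
      unfolding omega2_dlegendre_Suc_neighbours by (simp add: algebra_simps)
  qed simp
  also have "\<dots> = (real n + 1 + real m) * (real n + 2 + real m) * omega_moment u m n
    - (real n + 1 - real m) * (real n + 2 - real m) * omega_moment u m (n + 2)"
    unfolding omega_moment_def L2_inner_def by (simp add: int)
  finally show ?thesis .
qed

section \<open>Passing from mode m + 2 to mode m\<close>

lemma tendsto_0_if_square_le_harmonic:
  fixes f :: "nat \<Rightarrow> real"
  assumes "\<And>i. (real i + 1) * (f i)\<^sup>2 \<le> C"
  shows "f \<longlonglongrightarrow> 0"
proof -
  have "(\<lambda>i. (f i)\<^sup>2) \<longlonglongrightarrow> 0"
  proof (rule tendsto_sandwich)
    show "(\<lambda>i. 0 :: real) \<longlonglongrightarrow> 0" by simp
    show "\<forall>\<^sub>F i in sequentially. (f i)\<^sup>2 \<le> C * inverse (real (Suc i))"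
      using assms by (intro always_eventually allI) (simp add: field_simps)
    show "(\<lambda>i. C * inverse (real (Suc i))) \<longlonglongrightarrow> 0"
      using tendsto_mult_right_zero[OF LIMSEQ_inverse_real_of_nat] by simp
  qed auto
  then show ?thesis by simp
qed

text \<open>
  Indices are shifted by \<open>m\<close>, so \<open>A i\<close> and \<open>B i\<close> are the moments of degree \<open>m + i\<close> for the modes
  \<open>m\<close> and \<open>m + 2\<close>, and \<open>r i = i! / (2 m + i)!\<close>.  With \<open>X = A r\<close> the recurrence for the moments reads
  \<open>B (i + 2) - B i = g i (X i - X (i + 2))\<close>.  Summing it directly would lose a power of \<open>i\<close>, since
  the cancellation in \<open>B (i + 2) - B i\<close> would be ignored.  Therefore it is first summed by parts:
  \<open>Y = X + B / g\<close> satisfies \<open>Y i - Y (i + 2) = B (i + 2) (1 / g i - 1 / g (i + 2))\<close>, and the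
  difference \<open>d i\<close> of the reciprocals is smaller than \<open>1 / g i\<close> by a factor of order \<open>1 / i\<close>.
  The Hardy inequality controls \<open>Y\<close>, while \<open>B / g\<close> is bounded termwise by the coefficients of mode
  \<open>m + 2\<close>.
\<close>
lemma H_space_step: "H_space (m + 2) (real k) \<subseteq> H_space m (real k)"
proof
  fix u assume "u \<in> H_space (m + 2) (real k)"
  then have u: "u \<in> L2_interval"
    and sm: "summable (\<lambda>i. (2 * real (m + 2 + i) + 1) ^ (2 * k) *
      (L2_inner u (assoc_legendre (m + 2 + i) (m + 2)))\<^sup>2)"
    unfolding H_space_iff_summable by auto
  define U where "U = L2_inner u u"
  define N where "N i = 2 * real (m + i) + 1" for i
  define a where "a i = 2 * real m + real i + 1" for i
  define r where "r i = fact i / (fact (2 * m + i) :: real)" for i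
  define g where "g i = a i * (a i + 1) / r i" for i
  define A where "A i = omega_moment u m (m + i)" for i
  define B where "B i = omega_moment u (m + 2) (m + i)" for i
  define X where "X i = A i * r i" for i
  define Y where "Y i = X i + B i / g i" for i
  define c where "c i = (L2_inner u (assoc_legendre (m + i) m))\<^sup>2" for i
  define b where "b i = (L2_inner u (assoc_legendre (m + 2 + i) (m + 2)))\<^sup>2" for i
  \<comment> \<open>\<open>K\<close> is the factorial part of the squared normalization constant of mode \<open>m + 2\<close>, degree \<open>m + 2 + i\<close>.\<close>
  define K where "K i = r i / (a i * (a i + 1) * (a i + 2) * (a i + 3))" for i
  have a1: "1 \<le> a i" and ai: "real i + 1 \<le> a i" for i by (simp_all add: a_def)
  have r0: "0 < r i" for i by (simp add: r_def)
  have r1: "r i \<le> 1" for i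
    unfolding r_def by (simp add: fact_mono)
  have g0: "0 < g i" for i using a1[of i] r0[of i] by (simp add: g_def)
  have r_rec: "(real i + 1) * (real i + 2) * r i = a i * (a i + 1) * r (i + 2)" for i
  proof -
    have f1: "fact (2 * m + (i + 2)) = a i * (a i + 1) * fact (2 * m + i)"
      by (simp add: a_def algebra_simps)
    have f2: "fact (i + 2) = (real i + 1) * (real i + 2) * fact i"
      by (simp add: algebra_simps)
    show ?thesis unfolding r_def f1 f2 using a1[of i] by simp
  qed
  have K_eq: "K i = fact i / fact (2 * m + i + 4)" for i
  proof -
    have "fact (2 * m + i + 4) = (a i * (a i + 1) * (a i + 2) * (a i + 3)) * fact (2 * m + i)"
      by (simp add: a_def fact_reduce numeral_eq_Suc)
    then show ?thesis by (simp add: K_def r_def)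
  qed
  have c_eq: "c i = N i / 2 * (X i)\<^sup>2 / r i" for i
  proof -
    have idx: "m + i - m = i" "m + i + m = 2 * m + i" by simp_all
    have "c i = N i / 2 * r i * (A i)\<^sup>2"
      unfolding c_def L2_inner_assoc_legendre power_mult_distrib assoc_legendre_coeff_square idx
        N_def r_def A_def ..
    also have "\<dots> = N i / 2 * (X i)\<^sup>2 / r i"
      using r0[of i] by (simp add: X_def power2_eq_square)
    finally show ?thesis .
  qed
  have b_eq: "b i = N (i + 2) / 2 * (K i * (B (i + 2))\<^sup>2)" for i
  proof -
    have idx: "m + 2 + i - (m + 2) = i" "m + 2 + i + (m + 2) = 2 * m + i + 4" "m + 2 + i = m + (i + 2)"
      by simp_all
    show ?thesis
      unfolding b_def L2_inner_assoc_legendre power_mult_distrib assoc_legendre_coeff_square idx(1,2)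
        N_def K_eq B_def unfolding idx(3) by (rule mult.assoc)
  qed
  have B_rec: "B (i + 2) - B i = g i * (X i - X (i + 2))" for i
  proof -
    have "g i * X (i + 2) = a i * (a i + 1) * r (i + 2) / r i * A (i + 2)"
      by (simp add: g_def X_def)
    then have "(real i + 1) * (real i + 2) * A (i + 2) = g i * X (i + 2)"
      using r0[of i] unfolding r_rec[symmetric] by simp
    moreover have "a i * (a i + 1) * A i = g i * X i"
      using r0[of i] by (simp add: g_def X_def)
    moreover have "B (i + 2) - B i = a i * (a i + 1) * A i - (real i + 1) * (real i + 2) * A (i + 2)"
      using omega_moment_rec[OF u, of m "m + i"]
      by (simp add: A_def B_def a_def algebra_simps)
    ultimately show ?thesis by (simp add: right_diff_distrib)
  qed
  have Y_rec: "Y i - Y (i + 2) = B (i + 2) * (1 / g i - 1 / g (i + 2))" for i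
  proof -
    have "X i - X (i + 2) = (B (i + 2) - B i) / g i"
      unfolding B_rec using g0[of i] by simp
    then show ?thesis
      by (simp add: Y_def diff_divide_distrib right_diff_distrib)
  qed
  \<comment> \<open>The shift by two is kept in the form \<open>i + 2\<close>, in which the facts about \<open>a\<close>, \<open>r\<close> and \<open>g\<close> are stated.\<close>
  note [simp del] = add_2_eq_Suc add_2_eq_Suc'
  define x where "x = 2 * real m + 2"
  define d where "d i = r i / (a i * (a i + 1)) * (x * N (i + 2) / ((a i + 2) * (a i + 3)))" for i
  have a_Suc2: "a (i + 2) = a i + 2" for i by (simp add: a_def)
  have r_Suc2: "r (i + 2) = (real i + 1) * (real i + 2) * r i / (a i * (a i + 1))" for i
    unfolding r_rec using a1[of i] by auto
  have d_eq: "1 / g i - 1 / g (i + 2) = d i" for i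
  proof -
    have xN: "x * N (i + 2) = (a i + 2) * (a i + 3) - (real i + 1) * (real i + 2)"
      by (simp add: x_def N_def a_def algebra_simps)
    have ne: "(a i + 2) * (a i + 3) \<noteq> 0" using a1[of i] by auto
    have "1 / g (i + 2) = r (i + 2) / ((a i + 2) * (a i + 3))"
      by (simp add: g_def a_Suc2 add.assoc)
    also have "\<dots> = r i / (a i * (a i + 1)) * ((real i + 1) * (real i + 2) / ((a i + 2) * (a i + 3)))"
      unfolding r_Suc2 by simp
    finally have "1 / g i - 1 / g (i + 2) =
        r i / (a i * (a i + 1)) * (1 - (real i + 1) * (real i + 2) / ((a i + 2) * (a i + 3)))"
      unfolding right_diff_distrib by (simp add: g_def)
    also have "1 - (real i + 1) * (real i + 2) / ((a i + 2) * (a i + 3)) =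
        x * N (i + 2) / ((a i + 2) * (a i + 3))"
      unfolding xN diff_divide_distrib divide_self[OF ne] ..
    finally show ?thesis by (simp only: d_def)
  qed
  have N1: "real i + 1 \<le> N i" and N2: "N i \<le> x * (real i + 1)" for i
    by (simp_all add: N_def x_def algebra_simps)
  have N0: "0 < N i" for i using N1[of i] by linarith
  have x0: "0 < x" by (simp add: x_def)
  have d0: "0 \<le> d i" for i
    using a1[of i] r0[of i] N0[of "i + 2"] x0 unfolding d_def by auto
  \<comment> \<open>The mode \<open>m\<close> weight expressed for \<open>X\<close>, with one factor \<open>N i\<close> split off for the Hardy inequality.\<close>
  define v where "v i = N i ^ (2 * k) / r i" for i
  have "mono v"
  proof (rule incseq_SucI)
    fix i
    have eq: "r (Suc i) = r i * ((real i + 1) / a i)"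
      by (simp add: r_def a_def add_ac mult_ac)
    have "r (Suc i) \<le> r i * 1"
      unfolding eq using ai[of i] a1[of i] r0[of i] by (intro mult_left_mono) auto
    then show "v i \<le> v (Suc i)"
      unfolding v_def using r0 N0[of i]
      by (intro frac_le power_mono) (auto simp: N_def)
  qed
  have v0: "0 < v i" for i using N0 r0 by (simp add: v_def)
  define h where "h i = \<bar>B (i + 2)\<bar> * d i" for i
  have h_bound: "(real i + 1) ^ 3 * v i * (h i)\<^sup>2 \<le> 4 * x\<^sup>2 * (N (i + 2) ^ (2 * k) * b i)" for i
  proof -
    let ?D = "a i * (a i + 1) * (a i + 2) * (a i + 3)"
    have D0: "0 < ?D" using a1[of i] by auto
    have "(real i + 1) * (real i + 1) * (real i + 1) * N (i + 2) \<le> a i * (a i + 1) * (a i + 2) * (2 * (a i + 3))"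
      using a1[of i] ai[of i] N0[of "i + 2"] by (intro mult_mono) (auto simp: N_def a_def)
    also have "\<dots> = 2 * ?D"
      by (simp only: mult_ac)
    finally have frac: "(real i + 1) ^ 3 * N (i + 2) / ?D \<le> 2"
      unfolding pos_divide_le_eq[OF D0] power3_eq_cube .
    have b0: "0 \<le> b i" by (simp add: b_def)
    have dK: "(d i)\<^sup>2 / r i = K i * (x\<^sup>2 * (N (i + 2))\<^sup>2 / ?D)"
      using r0[of i] by (simp add: d_def K_def power2_eq_square mult_ac)
    have "(real i + 1) ^ 3 * v i * (h i)\<^sup>2 =
        N i ^ (2 * k) * ((real i + 1) ^ 3 * (B (i + 2))\<^sup>2 * ((d i)\<^sup>2 / r i))"
      by (simp add: v_def h_def power_mult_distrib)
    also have "\<dots> = N i ^ (2 * k) * (2 * x\<^sup>2 * b i * ((real i + 1) ^ 3 * N (i + 2) / ?D))"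
      unfolding dK b_eq by (simp add: power2_eq_square)
    also have "\<dots> \<le> N (i + 2) ^ (2 * k) * (2 * x\<^sup>2 * b i * 2)"
      using x0 frac b0 D0 N0[of i] N0[of "i + 2"]
      by (intro mult_mono power_mono mult_nonneg_nonneg) (auto simp: N_def)
    finally show ?thesis by (simp add: mult_ac)
  qed
  have sm_b: "summable (\<lambda>i. N (i + 2) ^ (2 * k) * b i)"
    using sm unfolding b_def N_def by (simp add: add_ac)
  have sm_h: "summable (\<lambda>i. (real i + 1) ^ 3 * v i * (h i)\<^sup>2)"
    by (rule summable_comparison_test'[OF summable_mult[OF sm_b, of "4 * x\<^sup>2"]])
       (use h_bound v0 in \<open>auto simp: abs_mult less_imp_le\<close>)
  have Bg: "N (i + 2) / 2 * (B (i + 2) / g (i + 2))\<^sup>2 / r (i + 2) \<le> b i" for i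
  proof -
    let ?q = "(real i + 1) * (real i + 2) / ((a i + 2) * (a i + 3))"
    have K0: "0 < K i" using a1[of i] r0[of i] unfolding K_def by auto
    have "(real i + 1) * (real i + 2) \<le> (a i + 2) * (a i + 3)"
      using ai[of i] a1[of i] by (intro mult_mono) auto
    then have q1: "?q \<le> 1" using a1[of i] by (simp add: divide_le_eq)
    have "1 / ((g (i + 2))\<^sup>2 * r (i + 2)) = r (i + 2) / ((a i + 2) * (a i + 3))\<^sup>2"
      using r0[of "i + 2"] by (simp add: g_def a_Suc2 power2_eq_square add.assoc)
    also have "\<dots> = K i * ?q"
      unfolding r_Suc2 K_def by (simp add: power2_eq_square mult_ac)
    finally have eq: "1 / ((g (i + 2))\<^sup>2 * r (i + 2)) = K i * ?q" .
    have "N (i + 2) / 2 * (B (i + 2) / g (i + 2))\<^sup>2 / r (i + 2) =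
        N (i + 2) / 2 * ((B (i + 2))\<^sup>2 * (1 / ((g (i + 2))\<^sup>2 * r (i + 2))))"
      by (simp add: power_divide)
    also have "\<dots> \<le> N (i + 2) / 2 * ((B (i + 2))\<^sup>2 * (K i * 1))"
      unfolding eq using q1 K0 N0[of "i + 2"] by (intro mult_left_mono) auto
    finally show ?thesis by (simp add: b_eq mult_ac)
  qed
  have le_r: "N i / 2 * z\<^sup>2 \<le> N i / 2 * z\<^sup>2 / r i" for i z
  proof -
    have "N i / 2 * z\<^sup>2 * r i \<le> N i / 2 * z\<^sup>2"
      using N0[of i] r0[of i] r1[of i] by (intro mult_left_le) auto
    then show ?thesis using r0[of i] by (simp add: le_divide_eq)
  qed
  have "X \<longlonglongrightarrow> 0"
  proof (rule tendsto_0_if_square_le_harmonic[where C = "2 * U"])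
    fix i
    have "(real i + 1) * (X i)\<^sup>2 \<le> N i * (X i)\<^sup>2"
      using N1[of i] by (intro mult_right_mono) auto
    moreover have "N i / 2 * (X i)\<^sup>2 \<le> U"
      using le_r[of i "X i"] coefficient_bound[OF u, of m "m + i"]
      unfolding c_eq[symmetric] U_def c_def by simp
    ultimately show "(real i + 1) * (X i)\<^sup>2 \<le> 2 * U" by simp
  qed
  moreover have "(\<lambda>i. B (i + 2) / g (i + 2)) \<longlonglongrightarrow> 0"
  proof (rule tendsto_0_if_square_le_harmonic[where C = "2 * U"])
    fix i
    have "(real i + 1) * (B (i + 2) / g (i + 2))\<^sup>2 \<le> N (i + 2) * (B (i + 2) / g (i + 2))\<^sup>2"
      using N1[of "i + 2"] by (intro mult_right_mono) auto
    moreover have "N (i + 2) / 2 * (B (i + 2) / g (i + 2))\<^sup>2 \<le> U"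
      using le_r[of "i + 2" "B (i + 2) / g (i + 2)"] Bg[of i]
        coefficient_bound[OF u, of "m + 2" "m + 2 + i"]
      unfolding U_def b_def by simp
    ultimately show "(real i + 1) * (B (i + 2) / g (i + 2))\<^sup>2 \<le> 2 * U" by simp
  qed
  then have "(\<lambda>i. B i / g i) \<longlonglongrightarrow> 0"
    by (rule LIMSEQ_offset)
  ultimately have "Y \<longlonglongrightarrow> 0"
    unfolding Y_def[abs_def] using tendsto_add by fastforce
  then have sm_Y: "summable (\<lambda>i. (real i + 1) * v i * (Y i)\<^sup>2)"
  proof (rule weighted_hardy[OF _ _ _ \<open>mono v\<close> v0 sm_h])
    fix i
    show "0 \<le> h i" using d0 by (simp add: h_def)
    have "\<bar>Y i - Y (i + 2)\<bar> = h i"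
      unfolding Y_rec d_eq h_def using d0[of i] by (simp add: abs_mult)
    then show "\<bar>Y i\<bar> \<le> \<bar>Y (i + 2)\<bar> + h i" by linarith
  qed
  \<comment> \<open>The estimate \<open>Bg\<close> needs degree at least \<open>m + 2\<close>, hence the shift of the summation index.\<close>
  have "summable (\<lambda>i. N i ^ (2 * k) * (N i * (B i / g i)\<^sup>2 / r i))"
  proof (subst summable_iff_shift[symmetric, of _ 2],
      rule summable_comparison_test'[OF summable_mult[OF sm_b, of 2]])
    fix i
    have "N (i + 2) ^ (2 * k) * (N (i + 2) * (B (i + 2) / g (i + 2))\<^sup>2 / r (i + 2)) \<le>
        N (i + 2) ^ (2 * k) * (2 * b i)"
      using Bg[of i] N0[of "i + 2"] by (intro mult_left_mono) auto
    then show "norm (N (i + 2) ^ (2 * k) * (N (i + 2) * (B (i + 2) / g (i + 2))\<^sup>2 / r (i + 2))) \<le>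
        2 * (N (i + 2) ^ (2 * k) * b i)"
      using N0[of "i + 2"] r0[of "i + 2"] by simp
  qed
  from summable_add[OF summable_mult[OF sm_Y, of x] this]
  have sm_total: "summable (\<lambda>i. x * ((real i + 1) * v i * (Y i)\<^sup>2) +
      N i ^ (2 * k) * (N i * (B i / g i)\<^sup>2 / r i))" .
  have "summable (\<lambda>i. N i ^ (2 * k) * c i)"
  proof (rule summable_comparison_test'[OF sm_total])
    fix i
    have "(X i)\<^sup>2 = (Y i - B i / g i)\<^sup>2" by (simp add: Y_def)
    also have "\<dots> \<le> 2 * ((Y i)\<^sup>2 + (B i / g i)\<^sup>2)"
      using zero_le_power2[of "Y i + B i / g i"] by (simp add: power2_sum power2_diff)
    finally have "N i / 2 * (X i)\<^sup>2 / r i \<le> N i / 2 * (2 * ((Y i)\<^sup>2 + (B i / g i)\<^sup>2)) / r i"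
      using N0[of i] r0[of i] by (intro divide_right_mono mult_left_mono) auto
    then have "N i ^ (2 * k) * c i \<le> N i ^ (2 * k) * (N i / 2 * (2 * ((Y i)\<^sup>2 + (B i / g i)\<^sup>2)) / r i)"
      unfolding c_eq using N0[of i] by (intro mult_left_mono) auto
    also have "\<dots> = N i * (v i * (Y i)\<^sup>2) + N i ^ (2 * k) * (N i * (B i / g i)\<^sup>2 / r i)"
      by (simp add: v_def add_divide_distrib distrib_left)
    also have "N i * (v i * (Y i)\<^sup>2) \<le> x * (real i + 1) * (v i * (Y i)\<^sup>2)"
      using N2[of i] v0[of i] by (intro mult_right_mono) auto
    finally show "norm (N i ^ (2 * k) * c i) \<le> x * ((real i + 1) * v i * (Y i)\<^sup>2) +
        N i ^ (2 * k) * (N i * (B i / g i)\<^sup>2 / r i)"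
      using N0[of i] by (simp add: c_def mult_ac)
  qed
  then show "u \<in> H_space m (real k)"
    using u unfolding H_space_iff_summable c_def N_def by simp
qed

lemma H_space_mono_even:
  assumes "m \<le> m'" "even (m' - m)"
  shows "H_space m' (real k) \<subseteq> H_space m (real k)"
proof -
  have "H_space (m + 2 * j) (real k) \<subseteq> H_space m (real k)" for j
  proof (induction j)
    case (Suc j)
    then show ?case using H_space_step[of "m + 2 * j" k] by (simp add: add.assoc)
  qed simp
  moreover obtain j where "m' = m + 2 * j"
    using assms by (metis dvdE le_add_diff_inverse)
  ultimately show ?thesis by simp
qed

section \<open>Powers of the weight as separating functions\<close>

definition omega_integral :: "nat \<Rightarrow> nat \<Rightarrow> nat \<Rightarrow> real" where
  "omega_integral p m n = integral {-1..1} (\<lambda>t. omega t ^ p * dlegendre m n t)"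

lemma L2_inner_omega_power:
  "L2_inner (\<lambda>t. omega t ^ m') (assoc_legendre n m) =
    assoc_legendre_coeff n m * omega_integral (m + m') m n"
proof -
  have "L2_inner (\<lambda>t. omega t ^ m') (assoc_legendre n m) =
      integral {-1..1} (\<lambda>t. omega t ^ m' * assoc_legendre n m t)"
    unfolding L2_inner_def
    by (intro continuous_on_interval_integral continuous_intros continuous_on_assoc_legendre)
  also have "\<dots> = integral {-1..1} (\<lambda>t. assoc_legendre_coeff n m * (omega t ^ (m + m') * dlegendre m n t))"
    by (simp add: assoc_legendre_eq power_add mult_ac)
  finally show ?thesis by (simp add: omega_integral_def)
qed

text \<open>
  Evaluate \<open>\<integral> \<omega>\<^sup>p\<^sup>+\<^sup>2 P\<^sub>n\<^sub>+\<^sub>1\<^sup>(\<^sup>m\<^sup>+\<^sup>1\<^sup>)\<close> in two ways: directly by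
  \<open>omega2_dlegendre_Suc_neighbours\<close>, and after an integration by parts by the three-term recurrence
  for \<open>t P\<^sub>n\<^sub>+\<^sub>1\<^sup>(\<^sup>m\<^sup>)\<close>.
\<close>
lemma omega_integral_rec:
  "(real n + 2 - real m) * (real n + real p + 3 - real m) * omega_integral p m (n + 2) =
    (real n + 1 + real m) * (real n + real m - real p) * omega_integral p m n"
proof -
  have lin: "integral {-1..1} (\<lambda>t. \<alpha> * (omega t ^ p * dlegendre m i t) + \<beta> * (omega t ^ p * dlegendre m j t)) =
      \<alpha> * omega_integral p m i + \<beta> * omega_integral p m j" for \<alpha> \<beta> i j
    unfolding omega_integral_def
    by (subst Henstock_Kurzweil_Integration.integral_add)
       (auto intro!: integrable_continuous_real continuous_intros)
  have parts: "integral {-1..1} (\<lambda>t. omega t ^ (p + 2) * dlegendre (Suc m) (Suc n) t) =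
      (real p + 2) * integral {-1..1} (\<lambda>t. omega t ^ p * (t * dlegendre m (Suc n) t))"
    by (intro integral_by_parts_omega has_real_derivative_dlegendre continuous_intros)
  have "(2 * real n + 3) * integral {-1..1} (\<lambda>t. omega t ^ (p + 2) * dlegendre (Suc m) (Suc n) t) =
      integral {-1..1} (\<lambda>t. (2 * real n + 3) * (omega t ^ (p + 2) * dlegendre (Suc m) (Suc n) t))"
    by simp
  also have "\<dots> = integral {-1..1} (\<lambda>t.
      (real n + 1 + real m) * (real n + 2 + real m) * (omega t ^ p * dlegendre m n t)
      + - ((real n + 1 - real m) * (real n + 2 - real m)) * (omega t ^ p * dlegendre m (n + 2) t))"
  proof (rule Henstock_Kurzweil_Integration.integral_cong)
    fix t :: real assume t: "t \<in> {-1..1}"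
    have "(2 * real n + 3) * (omega t ^ (p + 2) * dlegendre (Suc m) (Suc n) t) =
        omega t ^ p * ((2 * real n + 3) * ((1 - t\<^sup>2) * dlegendre (Suc m) (Suc n) t))"
      unfolding power_add omega_square[OF t] by simp
    then show "(2 * real n + 3) * (omega t ^ (p + 2) * dlegendre (Suc m) (Suc n) t) =
      (real n + 1 + real m) * (real n + 2 + real m) * (omega t ^ p * dlegendre m n t)
      + - ((real n + 1 - real m) * (real n + 2 - real m)) * (omega t ^ p * dlegendre m (n + 2) t)"
      unfolding omega2_dlegendre_Suc_neighbours by (simp add: algebra_simps)
  qed
  finally have 1: "(2 * real n + 3) * integral {-1..1} (\<lambda>t. omega t ^ (p + 2) * dlegendre (Suc m) (Suc n) t) =
      (real n + 1 + real m) * (real n + 2 + real m) * omega_integral p m n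
      + - ((real n + 1 - real m) * (real n + 2 - real m)) * omega_integral p m (n + 2)"
    unfolding lin .
  have "(2 * real n + 3) * integral {-1..1} (\<lambda>t. omega t ^ p * (t * dlegendre m (Suc n) t)) =
      integral {-1..1} (\<lambda>t. omega t ^ p * ((2 * real n + 3) * (t * dlegendre m (Suc n) t)))"
    by (subst Henstock_Kurzweil_Integration.integral_mult_right[symmetric]) (simp add: mult_ac)
  also have "\<dots> = integral {-1..1} (\<lambda>t. (real n + 2 - real m) * (omega t ^ p * dlegendre m (n + 2) t)
      + (real n + 1 + real m) * (omega t ^ p * dlegendre m n t))"
    unfolding dlegendre_three_term by (simp add: algebra_simps)
  finally have 2: "(2 * real n + 3) * integral {-1..1} (\<lambda>t. omega t ^ p * (t * dlegendre m (Suc n) t)) =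
      (real n + 2 - real m) * omega_integral p m (n + 2) + (real n + 1 + real m) * omega_integral p m n"
    unfolding lin .
  have "(2 * real n + 3) * integral {-1..1} (\<lambda>t. omega t ^ (p + 2) * dlegendre (Suc m) (Suc n) t) =
      (real p + 2) * ((2 * real n + 3) * integral {-1..1} (\<lambda>t. omega t ^ p * (t * dlegendre m (Suc n) t)))"
    unfolding parts by simp
  then show ?thesis
    unfolding 1 2 by (simp add: algebra_simps)
qed

text \<open>
  For \<open>p = 2 m\<close> the recurrence has the factor \<open>n - m\<close>, which kills all integrals of degree
  \<open>m + 2, m + 4, \<dots>\<close>; those of degree \<open>m + 1, m + 3, \<dots>\<close> vanish because \<open>P\<^sub>n\<^sup>(\<^sup>m\<^sup>)\<close> does for
  \<open>n = m - 1\<close> or, if \<open>m = 0\<close>, because \<open>\<integral> t = 0\<close>.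
\<close>
lemma omega_integral_eq_0: "m < n \<Longrightarrow> omega_integral (2 * m) m n = 0"
proof (induction n rule: less_induct)
  case (less n)
  show ?case
  proof (cases "n \<le> 1")
    case True
    with less.prems have "m = 0" "n = Suc 0" by auto
    moreover have "integral {-1..1} (\<lambda>t::real. t) = 0"
      using integral_by_parts_omega[of "\<lambda>_. 1" "\<lambda>_. 0" 0] by simp
    ultimately show ?thesis by (simp add: omega_integral_def dlegendre_0_1)
  next
    case False
    then obtain j where n: "n = j + 2" by (metis add.commute le_Suc_ex not_less_eq_eq numeral_2_eq_2 One_nat_def)
    have "(real j + real m - real (2 * m)) * omega_integral (2 * m) m j = 0"
    proof (cases j m rule: linorder_cases)
      case less
      then show ?thesis by (simp add: omega_integral_def dlegendre_eq_0)
    next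
      case greater
      then show ?thesis using less.IH[of j] n by simp
    qed simp
    then have "(real j + 2 - real m) * (real j + real (2 * m) + 3 - real m) * omega_integral (2 * m) m n = 0"
      using omega_integral_rec[of j m "2 * m"] unfolding n by simp
    moreover have "real j + 2 - real m > 0" "real j + real (2 * m) + 3 - real m > 0"
      using less.prems unfolding n by linarith+
    ultimately show ?thesis by simp
  qed
qed

lemma omega_power_in_L2: "(\<lambda>t. omega t ^ m) \<in> L2_interval"
  by (intro continuous_on_imp_L2_interval continuous_intros)

lemma omega_power_in_H_space: "(\<lambda>t. omega t ^ m) \<in> H_space m (real k)"
proof -
  have "summable (\<lambda>i. (2 * real (m + i) + 1) ^ (2 * k) *
      (L2_inner (\<lambda>t. omega t ^ m) (assoc_legendre (m + i) m))\<^sup>2)"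
  proof (rule summable_finite[of "{0}"])
    fix i :: nat assume "i \<notin> {0}"
    then have "omega_integral (m + m) m (m + i) = 0"
      using omega_integral_eq_0[of m "m + i"] by (simp add: mult_2)
    then show "(2 * real (m + i) + 1) ^ (2 * k) *
      (L2_inner (\<lambda>t. omega t ^ m) (assoc_legendre (m + i) m))\<^sup>2 = 0"
      unfolding L2_inner_omega_power by simp
  qed simp
  then show ?thesis by (simp only: H_space_iff_summable omega_power_in_L2)
qed

lemma omega_integral_start_pos: "0 < omega_integral p m m"
proof -
  obtain c where c: "c > 0" "\<And>t. dlegendre m m t = c" using dlegendre_top_pos by blast
  have cont: "continuous_on {-1..1} (\<lambda>t. omega t ^ p)" by (intro continuous_intros)
  have "integral {-1..1} (\<lambda>t. omega t ^ p) \<noteq> 0"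
    using integral_eq_0_iff[OF cont] omega_nonneg by (auto intro!: bexI[of _ 0] simp: omega_def)
  moreover have "0 \<le> integral {-1..1} (\<lambda>t. omega t ^ p)"
    by (rule Henstock_Kurzweil_Integration.integral_nonneg)
       (auto intro!: integrable_continuous_real cont zero_le_power omega_nonneg)
  ultimately show ?thesis
    using c by (simp add: omega_integral_def)
qed

lemma omega_integral_pochhammer:
  fixes m m' :: nat
  defines "\<alpha> \<equiv> real m + 1 / 2" and "\<beta> \<equiv> (real m - real m') / 2"
    and "\<gamma> \<equiv> (real m + real m' + 3) / 2"
  shows "omega_integral (m + m') m (m + 2 * i) = omega_integral (m + m') m m *
    (pochhammer (\<alpha>) i * pochhammer (\<beta>) i / (pochhammer 1 i * pochhammer (\<gamma>) i))"
proof (induction i)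
  case (Suc i)
  let ?E = "\<lambda>i. omega_integral (m + m') m (m + 2 * i)"
  have "((2 * (1 + real i)) * (2 * (\<gamma> + real i))) * ?E (Suc i) =
      ((2 * (\<alpha> + real i)) * (2 * (\<beta> + real i))) * ?E i"
  proof -
    have "2 * (1 + real i) = real (m + 2 * i) + 2 - real m"
      "2 * (\<gamma> + real i) = real (m + 2 * i) + real (m + m') + 3 - real m"
      "2 * (\<alpha> + real i) = real (m + 2 * i) + 1 + real m"
      "2 * (\<beta> + real i) = real (m + 2 * i) + real m - real (m + m')"
      by (simp_all add: \<alpha>_def \<beta>_def \<gamma>_def field_simps)
    moreover have "m + 2 * Suc i = m + 2 * i + 2" by simp
    ultimately show ?thesis
      by (simp only: omega_integral_rec)
  qed
  moreover have "0 < \<gamma> + real i"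
    unfolding \<gamma>_def by (intro add_pos_nonneg) auto
  moreover have "E' = E * (P * Q / (R * S))"
    if "((2 * R) * (2 * S)) * E' = ((2 * P) * (2 * Q)) * E" "0 < S" "0 < R" for E E' P Q R S :: real
    using that by (simp add: field_simps)
  ultimately have "?E (Suc i) = ?E i * ((\<alpha> + real i) * (\<beta> + real i) / ((1 + real i) * (\<gamma> + real i)))"
    by (meson add_pos_nonneg of_nat_0_le_iff zero_less_one)
  then show ?case unfolding Suc pochhammer_Suc by (simp add: mult_ac)
qed simp

text \<open>
  With \<open>\<alpha>\<close>, \<open>\<beta>\<close>, \<open>\<gamma>\<close> as in \<open>omega_integral_pochhammer\<close>, the excluded case is exactly the one where \<open>\<beta>\<close> is a pole of \<open>\<Gamma>\<close>, that is, where the Pochhammer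
  symbols of \<open>\<beta>\<close> vanish eventually.  The exponent is
  \<open>\<alpha> + \<beta> - 1 - \<gamma> = m - m' - 2\<close>.
\<close>
lemma omega_integral_lower_bound:
  assumes "\<not> (m \<le> m' \<and> even (m' - m))"
  obtains c where "c > 0"
    and "\<forall>\<^sub>F n in sequentially. c * real n powr (real m - real m' - 2) \<le>
      \<bar>omega_integral (m + m') m (m + 2 * (n + 1))\<bar>"
proof -
  define \<alpha> \<beta> \<gamma> where "\<alpha> = real m + 1 / 2" and "\<beta> = (real m - real m') / 2"
    and "\<gamma> = (real m + real m' + 3) / 2"
  \<comment> \<open>The shift by one matches the index of the Pochhammer symbol in \<open>rGamma_series\<close>.\<close>
  define E where "E n = omega_integral (m + m') m (m + 2 * (n + 1))" for n
  define L where "L = omega_integral (m + m') m m * (rGamma \<alpha> * rGamma \<beta> / (rGamma 1 * rGamma \<gamma>))"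
  have \<beta>: "\<beta> \<notin> \<int>\<^sub>\<le>\<^sub>0"
  proof
    assume "\<beta> \<in> \<int>\<^sub>\<le>\<^sub>0"
    then obtain n where "\<beta> = - real n" by (elim nonpos_Ints_cases')
    then have "real m' = real (m + 2 * n)" by (simp add: \<beta>_def field_simps)
    then have "m' = m + 2 * n" by (simp only: of_nat_eq_iff)
    with assms show False by simp
  qed
  have \<alpha>\<gamma>: "\<alpha> \<notin> \<int>\<^sub>\<le>\<^sub>0" "\<gamma> \<notin> \<int>\<^sub>\<le>\<^sub>0" "(1::real) \<notin> \<int>\<^sub>\<le>\<^sub>0"
    by (auto simp: \<alpha>_def \<gamma>_def elim!: nonpos_Ints_cases')
  have "(\<lambda>n. omega_integral (m + m') m m *
      (rGamma_series \<alpha> n * rGamma_series \<beta> n / (rGamma_series 1 n * rGamma_series \<gamma> n))) \<longlonglongrightarrow> L"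
    unfolding L_def using \<alpha>\<gamma> by (intro tendsto_intros) (simp_all add: rGamma_eq_zero_iff)
  moreover have "\<forall>\<^sub>F n in sequentially. omega_integral (m + m') m m *
      (rGamma_series \<alpha> n * rGamma_series \<beta> n / (rGamma_series 1 n * rGamma_series \<gamma> n)) =
      E n * real n powr (real m' + 2 - real m)"
    using eventually_gt_at_top[of 0]
  proof eventually_elim
    case (elim n)
    have rs: "rGamma_series z n = pochhammer z (n + 1) / (fact n * real n powr z)" for z :: real
      using elim by (simp add: rGamma_series_def powr_def)
    have "real n powr 1 * real n powr \<gamma> = real n powr (real m' + 2 - real m) * (real n powr \<alpha> * real n powr \<beta>)"
      unfolding powr_add[symmetric]
      by (rule arg_cong[where f = "(powr) (real n)"]) (simp add: \<alpha>_def \<beta>_def \<gamma>_def field_simps)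
    then have "(P / (fact n * real n powr \<alpha>)) * (Q / (fact n * real n powr \<beta>)) /
        ((R / (fact n * real n powr 1)) * (S / (fact n * real n powr \<gamma>))) =
        P * Q / (R * S) * real n powr (real m' + 2 - real m)" for P Q R S
      using elim by (simp add: field_simps)
    then show ?case
      unfolding rs E_def omega_integral_pochhammer \<alpha>_def \<beta>_def \<gamma>_def by simp
  qed
  ultimately have "(\<lambda>n. E n * real n powr (real m' + 2 - real m)) \<longlonglongrightarrow> L"
    by (rule Lim_transform_eventually)
  then have lim: "(\<lambda>n. \<bar>E n * real n powr (real m' + 2 - real m)\<bar>) \<longlonglongrightarrow> \<bar>L\<bar>"
    by (rule tendsto_rabs)
  have L0: "\<bar>L\<bar> > 0"
    using \<alpha>\<gamma> \<beta> omega_integral_start_pos[of "m + m'" m] by (simp add: L_def rGamma_eq_zero_iff)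
  then have "\<forall>\<^sub>F n in sequentially. \<bar>L\<bar> / 2 < \<bar>E n * real n powr (real m' + 2 - real m)\<bar>"
    by (intro order_tendstoD(1)[OF lim]) simp
  then have "\<forall>\<^sub>F n in sequentially. \<bar>L\<bar> / 2 * real n powr (real m - real m' - 2) \<le> \<bar>E n\<bar>"
    using eventually_gt_at_top[of 0]
  proof eventually_elim
    case (elim n)
    have "real n powr (real m' + 2 - real m) * real n powr (real m - real m' - 2) = 1"
      using elim(2) unfolding powr_add[symmetric] by simp
    then have "\<bar>E n\<bar> = \<bar>E n * real n powr (real m' + 2 - real m)\<bar> * real n powr (real m - real m' - 2)"
      by (simp add: abs_mult mult.assoc)
    with elim(1) show ?case by (metis less_imp_le mult_right_mono powr_ge_zero)
  qed
  then show thesis using that[of "\<bar>L\<bar> / 2"] L0 unfolding E_def by simp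
qed

text \<open>
  The squared normalization constant contributes the power \<open>1 - 2 m\<close> of the degree, the squared
  integral \<open>2 m - 2 m' - 4\<close>, and the weight at least \<open>2 m' + 2\<close>; these exponents add up to \<open>- 1\<close>.
  Only the degrees \<open>m + 2 (n + 1)\<close> are used.
\<close>
lemma omega_power_notin_H_space:
  assumes ne: "\<not> (m \<le> m' \<and> even (m' - m))" and "m' < k"
  shows "(\<lambda>t. omega t ^ m') \<notin> H_space m (real k)"
proof
  define f where "f i = (2 * real (m + i) + 1) ^ (2 * k) *
    (L2_inner (\<lambda>t. omega t ^ m') (assoc_legendre (m + i) m))\<^sup>2" for i
  assume "(\<lambda>t. omega t ^ m') \<in> H_space m (real k)"
  then have "summable f" unfolding H_space_iff_summable f_def by simp
  then have sm: "summable (f \<circ> (\<lambda>n. 2 * (n + 1)))"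
    by (rule summable_reindex) (auto simp: inj_def f_def)
  obtain c where c: "c > 0"
    and ev: "\<forall>\<^sub>F n in sequentially. c * real n powr (real m - real m' - 2) \<le>
      \<bar>omega_integral (m + m') m (m + 2 * (n + 1))\<bar>"
    using omega_integral_lower_bound[OF ne] by blast
  define C where "C = c\<^sup>2 / (2 * (2 * real m + 4) ^ (2 * m))"
  have C0: "C > 0" using c by (simp add: C_def)
  have "\<forall>\<^sub>F n in sequentially. norm (inverse (real n)) \<le> 1 / C * f (2 * (n + 1))"
    using ev eventually_gt_at_top[of 0]
  proof eventually_elim
    case (elim n)
    define N where "N = m + 2 * (n + 1)"
    have n1: "1 \<le> real n" using elim by simp
    have "fact (N + m) div fact (N + m - 2 * m) \<le> (N + m) ^ (2 * m)"
      by (rule fact_div_fact_le_pow) (simp add: N_def)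
    moreover have "(fact (N - m) :: nat) dvd fact (N + m)" by (rule fact_dvd) simp
    moreover have "N + m - 2 * m = N - m" by (simp add: N_def)
    ultimately have "fact (N + m) \<le> (N + m) ^ (2 * m) * (fact (N - m) :: nat)"
      by (metis dvd_div_mult_self mult_le_mono1)
    then have "real (fact (N + m)) \<le> real ((N + m) ^ (2 * m) * fact (N - m))"
      by (simp only: of_nat_le_iff)
    then have "(fact (N + m) :: real) \<le> (real N + real m) ^ (2 * m) * fact (N - m)"
      by simp
    also have "\<dots> \<le> ((2 * real m + 4) * real n) ^ (2 * m) * fact (N - m)"
    proof (intro mult_right_mono power_mono)
      have "real m * 1 \<le> real m * real n" using n1 by (intro mult_left_mono) auto
      then show "real N + real m \<le> (2 * real m + 4) * real n"
        using n1 unfolding N_def by (simp add: algebra_simps)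
    qed auto
    finally have le: "fact (N + m) \<le> ((2 * real m + 4) ^ (2 * m) * real n ^ (2 * m)) * fact (N - m)"
      by (simp only: power_mult_distrib)
    have "1 / D \<le> f / F" if "0 < D" "0 < F" "F \<le> D * f" for D F f :: real
      using that by (simp add: field_simps)
    from this[OF _ _ le] n1
    have fct: "1 / ((2 * real m + 4) ^ (2 * m) * real n ^ (2 * m)) \<le> fact (N - m) / fact (N + m)"
      by simp
    have "real n ^ (2 * m' + 2) \<le> (2 * real N + 1) ^ (2 * m' + 2)"
      by (intro power_mono) (simp_all add: N_def)
    also have "\<dots> \<le> (2 * real N + 1) ^ (2 * k)"
      using \<open>m' < k\<close> by (intro power_increasing) auto
    finally have pw: "real n ^ (2 * m' + 2) \<le> (2 * real N + 1) ^ (2 * k)" .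
    have en: "real n / 2 \<le> (2 * real N + 1) / 2" by (simp add: N_def)
    have om: "(c * real n powr (real m - real m' - 2))\<^sup>2 \<le> (omega_integral (m + m') m N)\<^sup>2"
      using power_mono[OF elim(1), of 2] c by (simp add: N_def)
    have "C * inverse (real n) = real n ^ (2 * m' + 2) * (real n / 2 *
        (1 / ((2 * real m + 4) ^ (2 * m) * real n ^ (2 * m))) * (c * real n powr (real m - real m' - 2))\<^sup>2)"
    proof -
      have "real n powr (real m - real m' - 2) = real n ^ m / (real n ^ m' * (real n)\<^sup>2)"
        using n1 powr_diff[of "real n" "real m" "real (m' + 2)"] powr_realpow[of "real n" m]
          powr_realpow[of "real n" "m' + 2"]
        by (simp add: diff_diff_eq add.commute power2_eq_square mult_ac)
      moreover have "real n ^ (2 * m' + 2) = (real n ^ m')\<^sup>2 * (real n)\<^sup>2" "real n ^ (2 * m) = (real n ^ m)\<^sup>2"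
        by (simp_all add: power_even_eq power2_eq_square)
      moreover have "c\<^sup>2 / (2 * q) * inverse x = b\<^sup>2 * x\<^sup>2 * (x / 2 * (1 / (q * a\<^sup>2)) * (c * (a / (b * x\<^sup>2)))\<^sup>2)"
        if "a > 0" "b > 0" "x > 0" "q > 0" for a b x q :: real
        using that by (simp add: field_simps power2_eq_square)
      moreover have "0 < (2 * real m + 4) ^ (2 * m)" by simp
      ultimately show ?thesis
        using n1 unfolding C_def by simp
    qed
    also have "\<dots> \<le> (2 * real N + 1) ^ (2 * k) * ((2 * real N + 1) / 2 *
        (fact (N - m) / fact (N + m)) * (omega_integral (m + m') m N)\<^sup>2)"
      by (intro mult_mono pw en fct om mult_nonneg_nonneg) auto
    also have "\<dots> = f (2 * (n + 1))"
      unfolding f_def L2_inner_omega_power power_mult_distrib assoc_legendre_coeff_square N_def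
      by simp
    finally show ?case using C0 by (simp add: field_simps)
  qed
  then have "summable (\<lambda>n. inverse (real n))"
    by (rule summable_comparison_test_ev) (use sm in \<open>intro summable_mult, simp add: o_def\<close>)
  then show False using not_summable_harmonic by blast
qed

theorem proposition7p6:
  fixes m m' k :: nat
  assumes "m < k" and "m' < k"
  shows "(H_space m' (real k) \<subseteq> H_space m (real k) \<longleftrightarrow> m \<le> m' \<and> even (m' - m)) \<and>
    (m \<le> m' \<and> even (m' - m) \<and> m' \<noteq> m \<longrightarrow> H_space m' (real k) \<subset> H_space m (real k))"
proof (intro conjI impI iffI)
  show incl: "H_space m' (real k) \<subseteq> H_space m (real k)" if "m \<le> m' \<and> even (m' - m)"
    using that H_space_mono_even by blast
  have not_incl: "\<not> H_space q (real k) \<subseteq> H_space p (real k)"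
    if "\<not> (p \<le> q \<and> even (q - p))" "q < k" for p q
    using omega_power_in_H_space[of q k] omega_power_notin_H_space[OF that] by blast
  show "m \<le> m'" "even (m' - m)" if "H_space m' (real k) \<subseteq> H_space m (real k)"
    using not_incl[of m m'] assms that by blast+
  show "H_space m' (real k) \<subset> H_space m (real k)" if "m \<le> m' \<and> even (m' - m) \<and> m' \<noteq> m"
  proof -
    have "\<not> (m' \<le> m \<and> even (m - m'))" using that by auto
    from not_incl[OF this \<open>m < k\<close>] show ?thesis using that H_space_mono_even[of m m' k] by blast
  qed
qed

end
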